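(* Let $S\subset\mathbb{R}^n$ be a polynomial image of the $m$-dimensional closed unit ball, that is, $S=f(\overline{B}_m)$ for some polynomial map $f:\mathbb{R}^m\to\mathbb{R}^n$, and assume that $f(\mathbb{R}^m)$ is not contained in a hyperplane of $\mathbb{R}^n$. Then the convex hull $\operatorname{conv}(S)$ is an $(m(n+1)+n)$-brick.
   Context: $\overline{B}_m$ denotes the closed unit ball of $\mathbb{R}^m$ centered at the origin; hyperplanes are affine hyperplanes. An $n$-dimensional semialgebraic set $T\subset\mathbb{R}^n$ is an $m$-brick if there exists a homotopy $H=(H_1,\ldots,H_n):[0,1]\times\overline{B}_m\to T$ such that: (1) each $H_i$ is the restriction to $[0,1]\times\overline{B}_m$ of a polynomial of the ring $\mathcal{C}^0([0,1])[x_1,\ldots,x_m]$, where $\mathcal{C}^0([0,1])$ is the ring of continuous real functions on $[0,1]$; (2) $H(\{0\}\times\overline{B}_m)=T$ and $H(1,\cdot)$ is a constant map; (3) $H(\{t\}\times\overline{B}_m)\subset\operatorname{Int}(T)$ for each $t\in(0,1)$, where $\operatorname{Int}$ is the topological interior in $\mathbb{R}^n$. *)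

theory Defs
  imports "HOL-Analysis.Analysis"
begin

text \<open>
  Where a dimension is a number occurring inside a formula, the Euclidean space of dimension \<open>m\<close>
  is represented by the functions \<open>x :: nat \<Rightarrow> real\<close> with \<open>x i = 0\<close> for all \<open>i \<ge> m\<close>. The product
  topology of \<open>nat \<Rightarrow> real\<close> induces the usual topology on these functions
  (compare \<open>Euclidean_space\<close>).
\<close>

definition closed_unit_ball :: "nat \<Rightarrow> (nat \<Rightarrow> real) set" where
  "closed_unit_ball m = {x. (\<forall>i\<ge>m. x i = 0) \<and> (\<Sum>i<m. (x i)\<^sup>2) \<le> 1}"

definition open_unit_cube :: "nat \<Rightarrow> (nat \<Rightarrow> real) set" where
  "open_unit_cube d = {x. (\<forall>i\<ge>d. x i = 0) \<and> (\<forall>i<d. 0 < x i \<and> x i < 1)}"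

inductive semialgebraic :: "'a::euclidean_space set \<Rightarrow> bool" where
  pos: "real_polynomial_function p \<Longrightarrow> semialgebraic {x. p x > 0}"
| compl: "semialgebraic A \<Longrightarrow> semialgebraic (- A)"
| union: "semialgebraic A \<Longrightarrow> semialgebraic B \<Longrightarrow> semialgebraic (A \<union> B)"
| inter: "semialgebraic A \<Longrightarrow> semialgebraic B \<Longrightarrow> semialgebraic (A \<inter> B)"

text \<open>
  The dimension of a nonempty semialgebraic set is the largest \<open>d\<close> for which the set contains a
  homeomorphic copy of the open cube \<open>(0,1)\<^sup>d\<close>. The empty set has no dimension in this sense.
\<close>

definition has_semialgebraic_dim :: "'a::euclidean_space set \<Rightarrow> nat \<Rightarrow> bool" where
  "has_semialgebraic_dim T d \<longleftrightarrow>
     (\<exists>U\<subseteq>T. U homeomorphic open_unit_cube d) \<and>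
     (\<forall>e. (\<exists>U\<subseteq>T. U homeomorphic open_unit_cube e) \<longrightarrow> e \<le> d)"

text \<open>
  Functions on \<open>[0,1] \<times> closed_unit_ball m\<close> that are restrictions of polynomials in
  \<open>x\<^sub>0, \<dots>, x\<^sub>m\<^sub>-\<^sub>1\<close> with coefficients in the ring of continuous real functions on \<open>[0,1]\<close>.
  The elements of \<open>A\<close> are the exponent vectors; their entries at positions \<open>i \<ge> m\<close> play no role.
\<close>

definition C0_polynomial_on_ball :: "nat \<Rightarrow> (real \<times> (nat \<Rightarrow> real) \<Rightarrow> real) \<Rightarrow> bool" where
  "C0_polynomial_on_ball m h \<longleftrightarrow>
     (\<exists>(A :: (nat \<Rightarrow> nat) set) (c :: (nat \<Rightarrow> nat) \<Rightarrow> real \<Rightarrow> real).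
        finite A \<and> (\<forall>\<alpha>\<in>A. continuous_on {0..1} (c \<alpha>)) \<and>
        (\<forall>t\<in>{0..1}. \<forall>x\<in>closed_unit_ball m.
           h (t, x) = (\<Sum>\<alpha>\<in>A. c \<alpha> t * (\<Prod>i<m. x i ^ \<alpha> i))))"

definition brick :: "nat \<Rightarrow> (real ^ 'n) set \<Rightarrow> bool" where
  "brick m T \<longleftrightarrow>
     semialgebraic T \<and> has_semialgebraic_dim T CARD('n) \<and>
     (\<exists>H :: real \<times> (nat \<Rightarrow> real) \<Rightarrow> real ^ 'n.
        continuous_on ({0..1} \<times> closed_unit_ball m) H \<and>
        H ` ({0..1} \<times> closed_unit_ball m) \<subseteq> T \<and>
        (\<forall>i. C0_polynomial_on_ball m (\<lambda>z. H z $ i)) \<and>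
        H ` ({0} \<times> closed_unit_ball m) = T \<and>
        (\<exists>c. \<forall>x\<in>closed_unit_ball m. H (1, x) = c) \<and>
        (\<forall>t\<in>{0<..<1}. H ` ({t} \<times> closed_unit_ball m) \<subseteq> interior T))"

definition hyperplane :: "'a::euclidean_space set \<Rightarrow> bool" where
  "hyperplane P \<longleftrightarrow> (\<exists>a b. a \<noteq> 0 \<and> P = {x. a \<bullet> x = b})"

end

theory Submission
  imports Defs "HOL-Computational_Algebra.Polynomial"
begin

text \<open>
  Let \<open>T\<close> be the convex hull of the image of the unit ball under \<open>f\<close>, let \<open>m = CARD('m)\<close>, \<open>n = CARD('n)\<close>
  and \<open>M = m (n + 1) + n\<close>.

  \<^emph>\<open>A polynomial map of the ball onto \<open>T\<close>.\<close> By Caratheodory's theorem \<open>T\<close> is the image of the product of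
  \<open>n + 1\<close> unit balls of dimension \<open>m\<close> and a cube of dimension \<open>n\<close> under a polynomial map (iterated convex
  combinations). The unit ball of dimension \<open>M\<close> is mapped polynomially onto this product: a multiple of
  \<open>s (1 - s\<^sup>2)\<^sup>n\<close> maps \<open>[0, 1]\<close> into itself and reaches \<open>1\<close> already at \<open>s = 1 / sqrt (2 n + 1)\<close>, so
  that, applied radially to each of the \<open>2 n + 1\<close> factors (and squared for the factors \<open>[0, 1]\<close> of the
  cube), it makes the unit ball cover the whole product (\<open>convex_hull_image_ball\<close>).

  \<^emph>\<open>The homotopy.\<close> As the range of \<open>f\<close> is not contained in a hyperplane and a polynomial is determined by its values
  on the ball, \<open>T\<close> has an interior point \<open>c\<close> (\<open>interior_convex_hull_image_ball\<close>). The linear contraction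
  of the above map to \<open>c\<close> stays in the interior of \<open>T\<close> for all positive times.

  \<^emph>\<open>Dimension.\<close> A small cube around \<open>c\<close> lies in \<open>T\<close>, and cubes of dimension greater than \<open>n\<close> are
  excluded by invariance of dimension (\<open>open_unit_cube_dimension_le\<close>).

  \<^emph>\<open>Semialgebraicity.\<close> \<open>T\<close> is the projection of a semialgebraic set, so the Tarski-Seidenberg theorem is
  needed. One variable is eliminated at a time, after the method of Cohen and Hoermander: the pattern of
  signs of finitely many polynomials in one variable is determined by the pattern of simpler ones,
  because on the critical points of \<open>P\<close> and the roots of the others the values of \<open>P\<close> are those of
  remainders, and in between \<open>P\<close> is monotone. Two systems with equal patterns are described
  by an increasing bijection of the line that preserves signs (\<open>matched_pair_adjust\<close>,
  \<open>sign_equivalent_extend\<close>). If the coefficients depend on parameters, induction gives a finite cover of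
  the parameter space by constructible sets with constant pattern (\<open>stratified_sign_equivalent\<close>), and
  whether the polynomials admit a common solution is constant on each of them (\<open>constructible_projection\<close>).
\<close>

section \<open>Order automorphisms of the line\<close>

text \<open>
  Two finite lists of polynomials in one variable have the same sign pattern along the line
  exactly if an increasing bijection \<open>\<phi>\<close> of the line carries the signs of the first list to those
  of the second. Such a \<open>\<phi>\<close> stands for the usual table of signs at the roots and between them, and
  it composes well with modifications that only move points within one cell.
\<close>

definition order_auto :: "(real \<Rightarrow> real) \<Rightarrow> bool" where
  "order_auto \<phi> \<longleftrightarrow> strict_mono \<phi> \<and> surj \<phi>"

text \<open>
  The cells of a finite set \<open>Z\<close> are its points and the components of its complement. Encoding
  "same cell" by signs of differences treats both kinds alike and makes it an equivalence relation
  by definition.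
\<close>

definition same_cell :: "real set \<Rightarrow> real \<Rightarrow> real \<Rightarrow> bool" where
  "same_cell Z a b \<longleftrightarrow> (\<forall>z\<in>Z. sgn (a - z) = sgn (b - z))"

lemma same_cell_refl [simp]: "same_cell Z a a"
  by (simp add: same_cell_def)

lemma same_cell_sym: "same_cell Z a b \<Longrightarrow> same_cell Z b a"
  unfolding same_cell_def by metis

lemma same_cell_trans: "same_cell Z a b \<Longrightarrow> same_cell Z b c \<Longrightarrow> same_cell Z a c"
  unfolding same_cell_def by metis

lemma same_cell_mono: "same_cell Z a b \<Longrightarrow> Y \<subseteq> Z \<Longrightarrow> same_cell Y a b"
  unfolding same_cell_def by blast

lemma same_cell_member: "same_cell Z a b \<Longrightarrow> a \<in> Z \<Longrightarrow> b = a"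
  unfolding same_cell_def by (metis diff_self eq_iff_diff_eq_0 sgn_0_0)

lemma same_cellI:
  assumes "\<And>z. z \<in> Z \<Longrightarrow> z < a \<and> z < b \<or> a < z \<and> b < z \<or> a = b"
  shows "same_cell Z a b"
  unfolding same_cell_def
proof
  fix z assume "z \<in> Z"
  from assms[OF this] show "sgn (a - z) = sgn (b - z)" by (elim disjE conjE) simp_all
qed

lemma same_cellD:
  assumes "same_cell Z a b" "z \<in> Z"
  shows "z < a \<longleftrightarrow> z < b" "a < z \<longleftrightarrow> b < z"
proof -
  have *: "sgn (a - z) = sgn (b - z)" using assms by (simp add: same_cell_def)
  have "0 < a - z \<longleftrightarrow> 0 < b - z" using * by (metis sgn_greater)
  then show "z < a \<longleftrightarrow> z < b" by simp
  have "a - z < 0 \<longleftrightarrow> b - z < 0" using * by (metis sgn_less)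
  then show "a < z \<longleftrightarrow> b < z" by simp
qed

lemma same_cell_between:
  assumes "same_cell Z a b" "min a b \<le> c" "c \<le> max a b"
  shows "same_cell Z a c"
proof (rule same_cellI)
  fix z assume z: "z \<in> Z"
  show "z < a \<and> z < c \<or> a < z \<and> c < z \<or> a = c"
    using same_cellD[OF assms(1) z] assms(2,3) by linarith
qed

lemma order_auto_id [simp]: "order_auto (\<lambda>t. t)"
  by (simp add: order_auto_def strict_mono_def)

lemma order_auto_comp: "order_auto \<phi> \<Longrightarrow> order_auto \<psi> \<Longrightarrow> order_auto (\<lambda>t. \<psi> (\<phi> t))"
  using comp_surj[of \<phi> \<psi>] by (auto simp: order_auto_def strict_mono_def o_def)

lemma order_auto_less: "order_auto \<phi> \<Longrightarrow> \<phi> a < \<phi> b \<longleftrightarrow> a < b"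
  by (simp add: order_auto_def strict_mono_less)

lemma order_auto_eq: "order_auto \<phi> \<Longrightarrow> \<phi> a = \<phi> b \<longleftrightarrow> a = b"
  by (simp add: order_auto_def strict_mono_eq)

lemma order_auto_inv: 
  assumes "order_auto \<phi>" shows "order_auto (inv \<phi>)" "\<phi> (inv \<phi> t) = t" "inv \<phi> (\<phi> t) = t"
proof -
  have i: "inj \<phi>" and s: "surj \<phi>"
    using assms by (auto simp: order_auto_def intro: strict_mono_imp_inj_on)
  show "\<phi> (inv \<phi> t) = t" "inv \<phi> (\<phi> t) = t"
    using i s by (auto simp: surj_f_inv_f)
  have "strict_mono (inv \<phi>)"
    using assms strict_mono_inv[of \<phi> "inv \<phi>"] i by (auto simp: order_auto_def)
  moreover have "surj (inv \<phi>)"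
    using i by (rule inj_imp_surj_inv)
  ultimately show "order_auto (inv \<phi>)" by (simp add: order_auto_def)
qed

lemma order_auto_sgn:
  assumes "order_auto \<phi>" shows "sgn (\<phi> a - \<phi> b) = sgn (a - b)"
proof (cases a b rule: linorder_cases)
  case less
  then have "\<phi> a < \<phi> b" using order_auto_less[OF assms] by simp
  with less show ?thesis by simp
next
  case greater
  then have "\<phi> b < \<phi> a" using order_auto_less[OF assms] by simp
  with greater show ?thesis by simp
qed simp

lemma same_cell_image:
  assumes "order_auto \<phi>" shows "same_cell (\<phi> ` Z) (\<phi> a) (\<phi> b) \<longleftrightarrow> same_cell Z a b"
  by (simp add: same_cell_def order_auto_sgn[OF assms])

text \<open>
  The bijection is the identity outside \<open>[a, b]\<close> and affine on \<open>[a, u]\<close> and \<open>[u, b]\<close>; exchanging \<open>u\<close>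
  and \<open>v\<close> gives its inverse.
\<close>

lemma order_auto_moving:
  fixes a b u v :: real
  assumes "a < u" "u < b" "a < v" "v < b"
  shows "\<exists>\<tau>. order_auto \<tau> \<and> \<tau> u = v \<and> (\<forall>y. y \<le> a \<or> b \<le> y \<longrightarrow> \<tau> y = y)"
proof -
  define T where "T = (\<lambda>u v y. if y \<le> a \<or> b \<le> y then y 
     else if y \<le> u then a + (y - a) * ((v - a) / (u - a)) else b - (b - y) * ((b - v) / (b - u)))"
  have rng1: "a < a + (y - a) * ((v - a) / (u - a))" "a + (y - a) * ((v - a) / (u - a)) \<le> v"
    if "a < u" "u < b" "a < v" "v < b" "a < y" "y \<le> u" for u v y
  proof -
    have "(y - a) * ((v - a) / (u - a)) \<le> (u - a) * ((v - a) / (u - a))"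
      using that by (intro mult_right_mono) auto
    then show "a < a + (y - a) * ((v - a) / (u - a))" "a + (y - a) * ((v - a) / (u - a)) \<le> v" 
      using that by simp_all
  qed
  have rng2: "b - (b - y) * ((b - v) / (b - u)) < b" "v < b - (b - y) * ((b - v) / (b - u))"
    if "a < u" "u < b" "a < v" "v < b" "y < b" "u < y" for u v y
  proof -
    have "(b - y) * ((b - v) / (b - u)) < (b - u) * ((b - v) / (b - u))"
      using that by (intro mult_strict_right_mono) auto
    then show "b - (b - y) * ((b - v) / (b - u)) < b" "v < b - (b - y) * ((b - v) / (b - u))"
      using that by simp_all
  qed
  have inv: "T v u (T u v y) = y" if "a < u" "u < b" "a < v" "v < b" for u v y
  proof -
    consider "y \<le> a \<or> b \<le> y" | "a < y" "y \<le> u" | "u < y" "y < b" by linarith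
    then show ?thesis
    proof cases
      case 1
      then show ?thesis by (simp add: T_def)
    next
      case 2
      have Ty: "T u v y = a + (y - a) * ((v - a) / (u - a))" 
        using 2 that by (simp add: T_def)
      have "T v u (T u v y) = a + (T u v y - a) * ((u - a) / (v - a))"
        using rng1[OF that 2] that Ty by (simp only: T_def) auto
      then show ?thesis using that by (simp add: Ty)
    next
      case 3
      have Ty: "T u v y = b - (b - y) * ((b - v) / (b - u))" 
        using 3 that by (simp add: T_def)
      have "T v u (T u v y) = b - (b - T u v y) * ((b - u) / (b - v))"
        using rng2[OF that 3(2) 3(1)] that Ty by (simp only: T_def) auto
      then show ?thesis using that by (simp add: Ty)
    qed
  qed
  have mono: "T u v x < T u v y" if "x < y" for x y
  proof -
    note r = rng1[OF assms] rng2[OF assms]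
    have below: "T u v y = y" if "y \<le> a \<or> b \<le> y" for y using that by (simp add: T_def)
    have left: "T u v y = a + (y - a) * ((v - a) / (u - a))" if "a < y" "y \<le> u" for y 
      using that assms by (simp add: T_def)
    have right: "T u v y = b - (b - y) * ((b - v) / (b - u))" if "u < y" "y < b" for y 
      using that assms by (simp add: T_def)
    have 1: "(x - a) * ((v - a) / (u - a)) < (y - a) * ((v - a) / (u - a))"
      using that assms by (intro mult_strict_right_mono) auto
    have 2: "(b - y) * ((b - v) / (b - u)) < (b - x) * ((b - v) / (b - u))"
      using that assms by (intro mult_strict_right_mono) auto
    have bnd: "a < T u v z \<and> T u v z \<le> v \<and> T u v z < b" if "a < z" "z \<le> u" for z
      using r(1,2)[OF that] assms(4) unfolding left[OF that] by linarith
    have bnd': "v < T u v z \<and> a < T u v z \<and> T u v z < b" if "u < z" "z < b" for z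
      using r(3,4)[OF that(2,1)] assms(3) unfolding right[OF that] by linarith
    consider "x \<le> a" | "b \<le> x" | "a < x" "x \<le> u" | "u < x" "x < b" by linarith
    then show ?thesis
    proof cases
      case 1
      then have "T u v x = x" using below by blast
      moreover consider "y \<le> a \<or> b \<le> y" | "a < y" "y \<le> u" | "u < y" "y < b" by linarith
      then have "y = T u v y \<or> a < T u v y" using below bnd bnd' by cases auto
      ultimately show ?thesis using 1 \<open>x < y\<close> by linarith
    next
      case 2
      then show ?thesis using below[of x] below[of y] \<open>x < y\<close> by simp
    next
      case x: 3
      consider "b \<le> y" | "y \<le> u" | "u < y" "y < b" by linarith
      then show ?thesis
      proof cases
        case 1
        then show ?thesis using below[of y] bnd[OF x] by linarith
      next
        case 2
        then show ?thesis using left[OF x] left[of y] x 1 \<open>x < y\<close> by linarith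
      next
        case 3
        then show ?thesis using bnd[OF x] bnd'[OF 3] by linarith
      qed
    next
      case x: 4
      show ?thesis
      proof (cases "b \<le> y")
        case True
        then show ?thesis using below[of y] bnd'[OF x] by linarith
      next
        case False
        then show ?thesis using right[OF x] right[of y] x 2 \<open>x < y\<close> by linarith
      qed
    qed
  qed
  have "order_auto (T u v)"
    unfolding order_auto_def using mono inv[of v u] assms by (metis strict_monoI surjI)
  moreover have "T u v u = v" using assms by (simp add: T_def)
  moreover have "\<forall>y. y \<le> a \<or> b \<le> y \<longrightarrow> T u v y = y" by (simp add: T_def)
  ultimately show ?thesis by blast
qed

text \<open>
  Within a bounded interval around \<open>u\<close> and \<open>v\<close> that avoids \<open>Z\<close>, the preceding lemma moves \<open>u\<close> to \<open>v\<close>;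
  every point stays in its cell, so that the signs of polynomials whose roots lie in \<open>Z\<close> are preserved.
\<close>

lemma order_auto_within_cell:
  assumes fin: "finite Z" and cell: "same_cell Z u v" 
  shows "\<exists>\<tau>. order_auto \<tau> \<and> \<tau> u = v \<and> (\<forall>y. same_cell Z y (\<tau> y))"
proof (cases "u = v")
  case True
  then show ?thesis by (intro exI[of _ "\<lambda>t. t"]) auto
next
  case False
  define L where "L = {z\<in>Z. z < u}"
  define G where "G = {z\<in>Z. z > u}"
  have Lv: "z < u \<and> z < v" if "z \<in> L" for z
    using that same_cellD[OF cell] by (auto simp: L_def)
  have Gv: "u < z \<and> v < z" if "z \<in> G" for z
    using that same_cellD[OF cell] by (auto simp: G_def)
  have u: "u \<notin> Z" using same_cell_member[OF cell] False by auto
  obtain a where a: "a < u" "a < v" "\<forall>z\<in>L. z \<le> a"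
  proof (cases "L = {}")
    case True
    then show ?thesis using that[of "min u v - 1"] by auto
  next
    case False
    have fL: "finite L" using fin by (simp add: L_def)
    have "Max L \<in> L" using False fL by simp
    then show ?thesis using that[of "Max L"] Lv Max_ge[OF fL] by auto
  qed
  obtain b where b: "u < b" "v < b" "\<forall>z\<in>G. b \<le> z"
  proof (cases "G = {}")
    case True
    then show ?thesis using that[of "max u v + 1"] by auto
  next
    case False
    have fG: "finite G" using fin by (simp add: G_def)
    have "Min G \<in> G" using False fG by simp
    then show ?thesis using that[of "Min G"] Gv Min_le[OF fG] by auto
  qed
  obtain \<tau> where t: "order_auto \<tau>" "\<tau> u = v" "\<forall>y. y \<le> a \<or> b \<le> y \<longrightarrow> \<tau> y = y"
    using order_auto_moving[of a u b v] a b by blast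
  have "same_cell Z y (\<tau> y)" for y
  proof (cases "y \<le> a \<or> b \<le> y")
    case True
    then have "\<tau> y = y" using t(3) by blast
    then show ?thesis by simp
  next
    case False
    then have "a < \<tau> y" "\<tau> y < b" 
      using t order_auto_less[OF t(1), of a y] order_auto_less[OF t(1), of y b] by auto
    moreover have "z \<le> a \<or> b \<le> z" if "z \<in> Z" for z
      using that a(3) b(3) u by (cases z u rule: linorder_cases) (auto simp: L_def G_def)
    ultimately show ?thesis using False by (intro same_cellI) fastforce
  qed
  with t show ?thesis by blast
qed

section \<open>Transferring the sign of a polynomial\<close>

text \<open>
  By the intermediate value theorem a change of sign would produce a root that separates \<open>a\<close> from \<open>b\<close>.
\<close>

lemma poly_sgn_same_cell:
  fixes p :: "real poly"
  assumes cell: "same_cell Z a b" and roots: "\<And>z. poly p z = 0 \<Longrightarrow> z \<in> Z"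
  shows "sgn (poly p a) = sgn (poly p b)"
proof -
  have *: "sgn (poly p a) = sgn (poly p b)" if "a < b" and cell: "same_cell Z a b" for a b
  proof (rule ccontr)
    assume ne: "sgn (poly p a) \<noteq> sgn (poly p b)"
    have "\<exists>z. a \<le> z \<and> z \<le> b \<and> poly p z = 0"
    proof (cases "poly p a = 0 \<or> poly p b = 0")
      case True
      then show ?thesis using \<open>a < b\<close> less_imp_le by blast
    next
      case False
      then have "poly p a * poly p b < 0"
        using ne by (cases "poly p a" "0::real" rule: linorder_cases; 
            cases "poly p b" "0::real" rule: linorder_cases) (auto intro: mult_neg_pos mult_pos_neg)
      then show ?thesis using poly_IVT[OF \<open>a < b\<close>, of p] by (auto intro: less_imp_le)
    qed
    then obtain z where "a \<le> z" "z \<le> b" "poly p z = 0" by blast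
    moreover have "z \<in> Z" using roots calculation by simp
    ultimately show False using same_cellD[OF cell, of z] \<open>a < b\<close> by linarith
  qed
  show ?thesis
  proof (cases a b rule: linorder_cases)
    case less
    then show ?thesis using cell by (rule *)
  next
    case greater
    then show ?thesis using same_cell_sym[OF cell] by (rule *[symmetric])
  qed simp
qed

text \<open>
  The mean value theorem between \<open>t\<close> and the root: the derivative keeps its sign in the cell.
\<close>

lemma poly_sgn_via_root:
  fixes p :: "real poly"
  assumes cell: "same_cell Z t w" and crit: "\<And>z. poly (pderiv p) z = 0 \<Longrightarrow> z \<in> Z"
    and root: "poly p w = 0"
  shows "sgn (poly p t) = sgn (t - w) * sgn (poly (pderiv p) t)"
proof (cases "t = w")
  case True
  then show ?thesis using root by simp
next
  case False
  obtain c where c: "min t w < c" "c < max t w" "poly p t - poly p w = (t - w) * poly (pderiv p) c"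
  proof (cases "t < w")
    case True
    obtain c where "t < c" "c < w" "poly p w - poly p t = (w - t) * poly (pderiv p) c"
      using poly_MVT[OF True] by blast
    then show ?thesis using True that[of c] by (simp add: algebra_simps)
  next
    case f: False
    then have "w < t" using False by simp
    then obtain c where "w < c" "c < t" "poly p t - poly p w = (t - w) * poly (pderiv p) c"
      using poly_MVT by blast
    then show ?thesis using f that[of c] by simp
  qed
  have "same_cell Z t c"
    using same_cell_between[OF cell] c(1,2) by simp
  then have "sgn (poly (pderiv p) t) = sgn (poly (pderiv p) c)"
    by (rule poly_sgn_same_cell) (rule crit)
  then show ?thesis using c(3) root by (simp add: sgn_mult)
qed

text \<open>
  From \<open>u\<close> on, \<open>q\<close> increases up to the next point of \<open>Z\<close>, where it is positive, so it vanishes in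
  between. If there is no next point, \<open>q\<close> increases on the whole ray and, being a nonconstant
  polynomial, becomes positive eventually.
\<close>

lemma poly_root_above:
  fixes q :: "real poly"
  assumes fin: "finite Z" and crit: "\<And>z. poly (pderiv q) z = 0 \<Longrightarrow> z \<in> Z"
    and u: "poly (pderiv q) u > 0" "poly q u < 0" "u \<notin> Z"
    and nxt: "\<And>b. b \<in> Z \<Longrightarrow> u < b \<Longrightarrow> \<forall>z\<in>Z. \<not> (u < z \<and> z < b) \<Longrightarrow> poly q b > 0"
  shows "\<exists>v. poly q v = 0 \<and> same_cell Z u v"
proof -
  have "\<exists>b>u. poly q b > 0 \<and> (\<forall>z\<in>Z. \<not> (u < z \<and> z < b))"
  proof (cases "{z\<in>Z. u < z} = {}")
    case False
    let ?G = "{z\<in>Z. u < z}"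
    have fG: "finite ?G" using fin by simp
    have "Min ?G \<in> ?G" using False fG by (rule Min_in[rotated])
    moreover have "\<forall>z\<in>Z. \<not> (u < z \<and> z < Min ?G)" using Min_le[OF fG] by force
    ultimately show ?thesis using nxt[of "Min ?G"] by blast
  next
    case True
    have pos: "poly (pderiv q) x > 0" if "u \<le> x" for x
    proof -
      have "same_cell Z u x" 
      proof (rule same_cellI)
        fix z assume "z \<in> Z"
        then have "z < u" using True u(3) by (cases z u rule: linorder_cases) auto
        then show "z < u \<and> z < x \<or> u < z \<and> x < z \<or> u = x" using that by simp
      qed
      then have "sgn (poly (pderiv q) u) = sgn (poly (pderiv q) x)"
        by (rule poly_sgn_same_cell) (rule crit)
      then show ?thesis using u(1) by (auto simp: sgn_if split: if_splits)
    qed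
    have d: "degree q \<noteq> 0" using u(1) pderiv_eq_0_iff[of q] by auto
    have lc': "lead_coeff (pderiv q) > 0"
    proof (rule ccontr)
      assume "\<not> lead_coeff (pderiv q) > 0"
      moreover have "pderiv q \<noteq> 0" using u(1) by auto
      ultimately have "lead_coeff (- pderiv q) > 0" by (simp add: less_le)
      then obtain n where "\<forall>x\<ge>n. poly (- pderiv q) x \<ge> lead_coeff (- pderiv q)"
        using poly_pinfty_gt_lc by blast
      from this[rule_format, of "max n u"] have "poly (- pderiv q) (max n u) > 0" 
        using \<open>lead_coeff (- pderiv q) > 0\<close> by linarith
      then show False using pos[of "max n u"] by simp
    qed
    have "lead_coeff q > 0"
      using lc' d by (simp add: degree_pderiv coeff_pderiv zero_less_mult_iff del: of_nat_Suc)
    then obtain n where n: "\<forall>x\<ge>n. poly q x \<ge> lead_coeff q"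
      using poly_pinfty_gt_lc by blast
    have "poly q (max n (u + 1)) > 0"
      using n[rule_format, of "max n (u + 1)"] \<open>lead_coeff q > 0\<close> by linarith
    then show ?thesis using True by (intro exI[of _ "max n (u + 1)"]) auto
  qed
  then obtain b where b: "b > u" "poly q b > 0" "\<forall>z\<in>Z. \<not> (u < z \<and> z < b)" by blast
  obtain v where v: "u < v" "v < b" "poly q v = 0"
    using poly_IVT_pos[OF b(1) u(2) b(2)] by blast
  have "same_cell Z u v"
  proof (rule same_cellI)
    fix z assume z: "z \<in> Z"
    then have "z < u \<or> b \<le> z" using b(3) u(3) z by (cases z u rule: linorder_cases) auto
    then show "z < u \<and> z < v \<or> u < z \<and> v < z \<or> u = v" using v by auto
  qed
  with v show ?thesis by blast
qed

lemma poly_root_below: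
  fixes q :: "real poly"
  assumes fin: "finite Z" and crit: "\<And>z. poly (pderiv q) z = 0 \<Longrightarrow> z \<in> Z"
    and u: "poly (pderiv q) u < 0" "poly q u < 0" "u \<notin> Z"
    and nxt: "\<And>b. b \<in> Z \<Longrightarrow> b < u \<Longrightarrow> \<forall>z\<in>Z. \<not> (b < z \<and> z < u) \<Longrightarrow> poly q b > 0"
  shows "\<exists>v. poly q v = 0 \<and> same_cell Z u v"
proof -
  define r where "r = pcompose q [:0, -1:]"
  have r: "poly r x = poly q (- x)" "poly (pderiv r) x = - poly (pderiv q) (- x)" for x
    by (simp_all add: r_def poly_pcompose pderiv_pcompose pderiv_pCons)
  have "\<exists>v. poly r v = 0 \<and> same_cell (uminus ` Z) (- u) v"
  proof (rule poly_root_above)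
    fix b assume b: "b \<in> uminus ` Z" "- u < b" "\<forall>z\<in>uminus ` Z. \<not> (- u < z \<and> z < b)"
    then have "\<forall>z\<in>Z. \<not> (- b < z \<and> z < u)" by auto
    then show "poly r b > 0" using nxt[of "- b"] b by (auto simp: r)
  next
    fix z assume "poly (pderiv r) z = 0"
    then show "z \<in> uminus ` Z" using crit[of "- z"] by (auto simp: r intro: image_eqI[of _ _ "- z"])
  qed (use fin u in \<open>auto simp: r\<close>)
  then obtain v where v: "poly r v = 0" "same_cell (uminus ` Z) (- u) v" by blast
  have "same_cell Z u (- v)"
    unfolding same_cell_def
  proof
    fix z assume "z \<in> Z"
    then have "sgn (- u - - z) = sgn (v - - z)" using v(2) unfolding same_cell_def by blast
    then have "sgn (- (u - z)) = sgn (- (- v - z))" by (simp add: algebra_simps)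
    then show "sgn (u - z) = sgn (- v - z)" by (simp only: sgn_minus neg_equal_iff_equal)
  qed
  with v show ?thesis by (intro exI[of _ "- v"]) (simp add: r)
qed

text \<open>
  The situation of the key step: \<open>\<phi>\<close> matches the signs of the derivatives everywhere, and the signs of
  \<open>p\<close> and \<open>q\<close> themselves on a finite set that contains all critical points of \<open>p\<close>. Then \<open>p\<close> and \<open>q\<close> are
  strictly monotone on corresponding cells, have signs of the same kind at corresponding ends, and
  so have a root in the same cells; only the position of \<open>\<phi> w\<close> for a root \<open>w\<close> of \<open>p\<close> may be wrong.
  The hypotheses are symmetric under negating both polynomials and under inverting \<open>\<phi>\<close>.
\<close>

locale matched_pair =
  fixes Z :: "real set" and \<phi> :: "real \<Rightarrow> real" and p q :: "real poly"
  assumes fin: "finite Z" and auto: "order_auto \<phi>"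
    and crit_p: "poly (pderiv p) z = 0 \<Longrightarrow> z \<in> Z"
    and deriv: "sgn (poly (pderiv p) t) = sgn (poly (pderiv q) (\<phi> t))"
    and vals: "z \<in> Z \<Longrightarrow> sgn (poly p z) = sgn (poly q (\<phi> z))"
begin

lemma crit_q: "poly (pderiv q) u = 0 \<Longrightarrow> u \<in> \<phi> ` Z"
  using crit_p[of "inv \<phi> u"] deriv[of "inv \<phi> u"] order_auto_inv(2)[OF auto, of u]
  by (auto simp: sgn_0_0 intro!: image_eqI[of _ _ "inv \<phi> u"])

lemma mem_image: "\<phi> t \<in> \<phi> ` Z \<longleftrightarrow> t \<in> Z"
  using order_auto_eq[OF auto] by auto

lemma uminus: "matched_pair Z \<phi> (- p) (- q)"
  by unfold_locales (use fin auto crit_p deriv vals in \<open>auto simp: pderiv_minus sgn_minus\<close>)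

lemma inverse: "matched_pair (\<phi> ` Z) (inv \<phi>) q p"
  by unfold_locales 
    (use fin auto crit_q deriv vals order_auto_inv[OF auto] in auto)

text \<open>
  A value of \<open>q\<close> with the wrong sign forces a root of \<open>q\<close> in that cell: in the direction in which both
  polynomials increase, \<open>p\<close> is positive at the end of the cell, hence so is \<open>q\<close>; if the cell is
  unbounded there, \<open>q\<close> becomes positive anyway.
\<close>

lemma root_in_cell_if_negative:
  assumes w: "w \<notin> Z" "poly p w \<ge> 0" "poly q (\<phi> w) < 0"
  shows "\<exists>v. poly q v = 0 \<and> same_cell (\<phi> ` Z) (\<phi> w) v"
proof -
  have pw: "poly (pderiv p) w \<noteq> 0" using w crit_p by blast
  have sg: "sgn (poly (pderiv p) x) = sgn (poly (pderiv p) w)" if "same_cell Z w x" for x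
    using poly_sgn_same_cell[OF that, of "pderiv p"] crit_p by simp
  show ?thesis
  proof (cases "poly (pderiv p) w > 0")
    case True
    show ?thesis
    proof (rule poly_root_above)
      show "poly (pderiv q) (\<phi> w) > 0" using True deriv[of w] by (auto simp: sgn_if split: if_splits)
      fix b assume b: "b \<in> \<phi> ` Z" "\<phi> w < b" "\<forall>z\<in>\<phi> ` Z. \<not> (\<phi> w < z \<and> z < b)"
      then obtain z where z: "z \<in> Z" "b = \<phi> z" by blast
      have wz: "w < z" "\<forall>y\<in>Z. \<not> (w < y \<and> y < z)"
        using b z order_auto_less[OF auto] by auto
      obtain c where c: "w < c" "c < z" "poly p z - poly p w = (z - w) * poly (pderiv p) c"
        using poly_MVT[OF wz(1)] by blast
      have "same_cell Z w c"
      proof (rule same_cellI)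
        fix y assume y: "y \<in> Z"
        then have "y \<noteq> w" using w(1) by auto
        then show "y < w \<and> y < c \<or> w < y \<and> c < y \<or> w = c" using c(1,2) wz y by fastforce
      qed
      then have "poly (pderiv p) c > 0" using sg[of c] True by (auto simp: sgn_if split: if_splits)
      then have "(z - w) * poly (pderiv p) c > 0" using wz by simp
      then have "poly p z > 0" using c w(2) by linarith
      then show "poly q b > 0" using vals[OF z(1)] z(2) by (auto simp: sgn_if split: if_splits)
    qed (use fin w crit_q mem_image in auto)
  next
    case False
    then have neg: "poly (pderiv p) w < 0" using pw by simp
    show ?thesis
    proof (rule poly_root_below)
      show "poly (pderiv q) (\<phi> w) < 0" using neg deriv[of w] by (auto simp: sgn_if split: if_splits)
      fix b assume b: "b \<in> \<phi> ` Z" "b < \<phi> w" "\<forall>z\<in>\<phi> ` Z. \<not> (b < z \<and> z < \<phi> w)"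
      then obtain z where z: "z \<in> Z" "b = \<phi> z" by blast
      have wz: "z < w" "\<forall>y\<in>Z. \<not> (z < y \<and> y < w)"
        using b z order_auto_less[OF auto] by auto
      obtain c where c: "z < c" "c < w" "poly p w - poly p z = (w - z) * poly (pderiv p) c"
        using poly_MVT[OF wz(1)] by blast
      have "same_cell Z w c"
      proof (rule same_cellI)
        fix y assume y: "y \<in> Z"
        then have "y \<noteq> w" using w(1) by auto
        then show "y < w \<and> y < c \<or> w < y \<and> c < y \<or> w = c" using c(1,2) wz y by fastforce
      qed
      then have "poly (pderiv p) c < 0" using sg[of c] neg by (auto simp: sgn_if split: if_splits)
      then have "(w - z) * poly (pderiv p) c < 0" using wz by (simp add: mult_pos_neg)
      then have "poly p z > 0" using c w(2) by linarith
      then show "poly q b > 0" using vals[OF z(1)] z(2) by (auto simp: sgn_if split: if_splits)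
    qed (use fin w crit_q mem_image in auto)
  qed
qed

lemma root_in_cell:
  assumes "sgn (poly q (\<phi> w)) \<noteq> sgn (poly p w)" "poly q (\<phi> w) \<noteq> 0"
  shows "\<exists>v. poly q v = 0 \<and> same_cell (\<phi> ` Z) (\<phi> w) v"
proof -
  have w: "w \<notin> Z" using vals[of w] assms(1) by auto
  consider "poly p w \<ge> 0" "poly q (\<phi> w) < 0" | "poly p w \<le> 0" "poly q (\<phi> w) > 0"
  proof (cases "poly q (\<phi> w) < 0")
    case True
    then have "poly p w \<ge> 0" using assms(1) by (metis not_le sgn_neg)
    then show ?thesis using True that by blast
  next
    case False
    then have pos: "poly q (\<phi> w) > 0" using assms(2) by simp
    then have "poly p w \<le> 0" using assms(1) by (metis not_le sgn_pos)
    then show ?thesis using pos that by blast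
  qed
  then show ?thesis
  proof cases
    case 1
    show ?thesis by (rule root_in_cell_if_negative[OF w 1])
  next
    case 2
    interpret neg: matched_pair Z \<phi> "- p" "- q" by (rule uminus)
    show ?thesis using neg.root_in_cell_if_negative[OF w] 2 by simp
  qed
qed

text \<open>
  If the signs differed at \<open>t\<close>, the inverse situation would give a root \<open>w\<close> of \<open>p\<close> in the cell of \<open>t\<close>, and
  \<open>\<phi> w\<close> would be a root of \<open>q\<close>. Then both signs are determined by the side of the root and the sign of
  the derivative, which correspond under \<open>\<phi>\<close>.
\<close>

lemma signs_agree:
  assumes good: "\<And>w. poly p w = 0 \<Longrightarrow> poly q (\<phi> w) = 0"
  shows "sgn (poly p t) = sgn (poly q (\<phi> t))"
proof (rule ccontr)
  assume ne: "sgn (poly p t) \<noteq> sgn (poly q (\<phi> t))"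
  have t: "t \<notin> Z" using ne vals by blast
  have p0: "poly p t \<noteq> 0" using ne good by auto
  interpret inv: matched_pair "\<phi> ` Z" "inv \<phi>" q p by (rule inverse)
  have "\<exists>w. poly p w = 0 \<and> same_cell (inv \<phi> ` \<phi> ` Z) (inv \<phi> (\<phi> t)) w"
    using inv.root_in_cell[of "\<phi> t"] ne p0 order_auto_inv(3)[OF auto] by auto
  then obtain w where w: "poly p w = 0" "same_cell Z t w"
    using order_auto_inv(3)[OF auto] by (auto simp: image_image)
  have s1: "sgn (poly p t) = sgn (t - w) * sgn (poly (pderiv p) t)"
    using w crit_p by (intro poly_sgn_via_root) auto
  have "sgn (poly q (\<phi> t)) = sgn (\<phi> t - \<phi> w) * sgn (poly (pderiv q) (\<phi> t))"
    using w good crit_q same_cell_image[OF auto] by (intro poly_sgn_via_root[of "\<phi> ` Z"]) auto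
  then show False using s1 ne order_auto_sgn[OF auto] deriv by simp
qed

end

text \<open>
  The roots of \<open>p\<close> that do not yet go to roots of \<open>q\<close> are corrected one at a time. Each correction
  composes \<open>\<phi>\<close> with a bijection that fixes the points of \<open>\<phi> ` Z\<close> and the images of the roots corrected
  before.
\<close>

lemma matched_pair_adjust:
  assumes "matched_pair Z \<phi> p q"
  shows "\<exists>\<psi>. order_auto \<psi> \<and> (\<forall>t. same_cell (\<phi> ` Z) (\<phi> t) (\<psi> t)) \<and>
    (\<forall>t. sgn (poly p t) = sgn (poly q (\<psi> t)))"
  using assms
proof (induction "card {w. poly p w = 0 \<and> poly q (\<phi> w) \<noteq> 0}" arbitrary: \<phi> rule: less_induct)
  case less
  interpret matched_pair Z \<phi> p q by (rule less.prems)
  let ?B = "\<lambda>\<phi>. {w. poly p w = 0 \<and> poly q (\<phi> w) \<noteq> 0}"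
  have "pderiv p \<noteq> 0"
  proof
    assume "pderiv p = 0"
    then have "Z = UNIV" using crit_p by auto
    then show False using fin infinite_UNIV_char_0[where 'a=real] by simp
  qed
  then have p0: "p \<noteq> 0" by auto
  have finp: "finite {w. poly p w = 0}" using poly_roots_finite[OF p0] .
  show ?case
  proof (cases "?B \<phi> = {}")
    case True
    then have "sgn (poly p t) = sgn (poly q (\<phi> t))" for t using signs_agree by blast
    then show ?thesis using auto by (intro exI[of _ \<phi>]) simp
  next
    case False
    then obtain w where w: "poly p w = 0" "poly q (\<phi> w) \<noteq> 0" by blast
    obtain v where v: "poly q v = 0" "same_cell (\<phi> ` Z) (\<phi> w) v" 
      using root_in_cell[of w] w by (auto simp: sgn_zero_iff)
    define K where "K = \<phi> ` {x. poly p x = 0 \<and> poly q (\<phi> x) = 0}"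
    have finK: "finite K" unfolding K_def using finp by (auto intro: finite_subset[of _ "{w. poly p w = 0}"])
    \<comment> \<open>By Rolle's theorem a critical point lies between two roots of \<open>p\<close>; its image in \<open>\<phi> ` Z\<close> keeps
      the segment from \<open>\<phi> w\<close> to \<open>v\<close> away from the roots that are already correct.\<close>
    have "same_cell K (\<phi> w) v"
    proof (rule ccontr)
      assume "\<not> same_cell K (\<phi> w) v"
      then obtain x where x: "poly p x = 0" "poly q (\<phi> x) = 0" "sgn (\<phi> w - \<phi> x) \<noteq> sgn (v - \<phi> x)"
        by (auto simp: same_cell_def K_def)
      have "w \<noteq> x" using x w by auto
      obtain c where c: "min x w < c" "c < max x w" "poly (pderiv p) c = 0"
      proof (cases "x < w")
        case True
        then show ?thesis using poly_MVT[OF True, of p] x(1) w(1) that by auto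
      next
        case f: False
        then have "w < x" using \<open>w \<noteq> x\<close> by simp
        then show ?thesis using poly_MVT[OF \<open>w < x\<close>, of p] x(1) w(1) that by auto
      qed
      then have "\<phi> c \<in> \<phi> ` Z" using crit_p by auto
      note D = same_cellD[OF v(2) this]
      have "x < c \<and> c < w \<and> \<phi> x < \<phi> c \<and> \<phi> c < \<phi> w \<or> w < c \<and> c < x \<and> \<phi> w < \<phi> c \<and> \<phi> c < \<phi> x"
        using c order_auto_less[OF auto] by (cases "x < w") auto
      then have "\<phi> x < \<phi> w \<and> \<phi> x < v \<or> \<phi> w < \<phi> x \<and> v < \<phi> x" using D by auto
      then show False using x(3) by auto
    qed
    with v(2) have "same_cell (\<phi> ` Z \<union> K) (\<phi> w) v" by (auto simp: same_cell_def)
    then obtain \<tau> where \<tau>: "order_auto \<tau>" "\<tau> (\<phi> w) = v" "\<And>y. same_cell (\<phi> ` Z \<union> K) y (\<tau> y)"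
      using order_auto_within_cell[of "\<phi> ` Z \<union> K"] finK fin by blast
    define \<psi> where "\<psi> = (\<lambda>t. \<tau> (\<phi> t))"
    have cell: "same_cell (\<phi> ` Z \<union> K) (\<phi> t) (\<psi> t)" for t using \<tau>(3) by (simp add: \<psi>_def)
    have cellZ: "same_cell (\<phi> ` Z) (\<phi> t) (\<psi> t)" for t using same_cell_mono[OF cell] by simp
    have fixd: "\<psi> t = \<phi> t" if "\<phi> t \<in> \<phi> ` Z \<union> K" for t 
      using same_cell_member[OF cell that] .
    have imZ: "\<psi> ` Z = \<phi> ` Z" using fixd by (intro image_cong) auto
    have mp: "matched_pair Z \<psi> p q"
    proof
      show "order_auto \<psi>" unfolding \<psi>_def by (rule order_auto_comp[OF auto \<tau>(1)])
      fix t show "sgn (poly (pderiv p) t) = sgn (poly (pderiv q) (\<psi> t))"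
        using deriv[of t] poly_sgn_same_cell[OF cellZ, of "pderiv q" t] crit_q by simp
    next
      fix z assume "z \<in> Z"
      then show "sgn (poly p z) = sgn (poly q (\<psi> z))" using vals fixd by auto
    qed (use fin crit_p in auto)
    have "?B \<psi> \<subset> ?B \<phi>"
    proof
      show "?B \<psi> \<subseteq> ?B \<phi>" using fixd by (force simp: K_def)
      have "w \<in> ?B \<phi>" "w \<notin> ?B \<psi>" using w v(1) \<tau>(2) by (auto simp: \<psi>_def)
      then show "?B \<psi> \<noteq> ?B \<phi>" by blast
    qed
    then have "card (?B \<psi>) < card (?B \<phi>)" using finp by (intro psubset_card_mono) auto
    from less.hyps[OF this mp] obtain \<omega> where \<omega>: "order_auto \<omega>" 
      "\<And>t. same_cell (\<psi> ` Z) (\<psi> t) (\<omega> t)" "\<And>t. sgn (poly p t) = sgn (poly q (\<omega> t))" by blast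
    have "same_cell (\<phi> ` Z) (\<phi> t) (\<omega> t)" for t
      using same_cell_trans[OF cellZ] \<omega>(2) imZ by simp
    with \<omega> show ?thesis by blast
  qed
qed

section \<open>Constructible sets and piecewise fractions\<close>

text \<open>
  Boolean combinations of positivity sets, for an arbitrary set \<open>R\<close> of real functions on an arbitrary
  parameter set. Working over such an abstract \<open>R\<close> makes it possible to eliminate variables one after
  another, with the polynomials in the remaining variables as \<open>R\<close>.
\<close>

inductive_set constructible :: "('x \<Rightarrow> real) set \<Rightarrow> 'x set set" for R where
  pos: "p \<in> R \<Longrightarrow> {x. p x > 0} \<in> constructible R"
| compl: "A \<in> constructible R \<Longrightarrow> - A \<in> constructible R"
| union: "A \<in> constructible R \<Longrightarrow> B \<in> constructible R \<Longrightarrow> A \<union> B \<in> constructible R"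

lemma constructible_inter:
  assumes "A \<in> constructible R" "B \<in> constructible R" shows "A \<inter> B \<in> constructible R"
proof -
  have "- (- A \<union> - B) \<in> constructible R"
    by (intro constructible.intros assms)
  then show ?thesis by simp
qed

text \<open>
  Division with remainder of polynomials whose coefficients depend on a parameter requires the
  inverses of leading coefficients and case distinctions on the degree. This class of coefficients is
  closed under both, so that no pseudo-division is needed. By \<open>x / 0 = 0\<close> the class contains the
  pointwise quotient of any two of its members.
\<close>

inductive_set piecewise_fractions :: "('x \<Rightarrow> real) set \<Rightarrow> ('x \<Rightarrow> real) set" for R where
  frac: "p \<in> R \<Longrightarrow> q \<in> R \<Longrightarrow> (\<lambda>x. p x / q x) \<in> piecewise_fractions R"
| glue: "g \<in> piecewise_fractions R \<Longrightarrow> h \<in> piecewise_fractions R \<Longrightarrow> A \<in> constructible R \<Longrightarrow>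
    (\<lambda>x. if x \<in> A then g x else h x) \<in> piecewise_fractions R"

section \<open>Sign patterns of families of polynomials\<close>

definition sign_equivalent :: "('x \<Rightarrow> real poly) set \<Rightarrow> 'x \<Rightarrow> 'x \<Rightarrow> bool" where
  "sign_equivalent F x y \<longleftrightarrow> 
    (\<exists>\<phi>. order_auto \<phi> \<and> (\<forall>P\<in>F. \<forall>t. sgn (poly (P x) t) = sgn (poly (P y) (\<phi> t))))"

text \<open>
  With the value \<open>0\<close> at \<open>Q x = 0\<close> the remainder is always zero or of smaller degree than \<open>Q x\<close>,
  whereas \<open>P x mod 0\<close> is \<open>P x\<close>.
\<close>

definition remainder :: "('x \<Rightarrow> real poly) \<Rightarrow> ('x \<Rightarrow> real poly) \<Rightarrow> 'x \<Rightarrow> real poly" where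
  "remainder P Q x = (if Q x = 0 then 0 else P x mod Q x)"

lemma poly_remainder:
  assumes "Q x \<noteq> 0" "poly (Q x) z = 0" shows "poly (remainder P Q x) z = poly (P x) z"
proof -
  have "poly (P x) z = poly (P x div Q x * Q x) z + poly (P x mod Q x) z" 
    by (metis poly_add div_mult_mod_eq)
  then show ?thesis using assms by (simp add: remainder_def)
qed

lemma sgn_poly_all_zero:
  fixes p q :: "real poly"
  assumes "surj \<phi>" "\<And>t. sgn (poly p t) = sgn (poly q (\<phi> t))"
  shows "p = 0 \<longleftrightarrow> q = 0"
proof -
  have eq: "poly p t = 0 \<longleftrightarrow> poly q (\<phi> t) = 0" for t using assms(2)[of t] by (metis sgn_zero_iff)
  have "p = 0 \<longleftrightarrow> (\<forall>t. poly p t = 0)" by (simp add: poly_all_0_iff_0)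
  also have "\<dots> \<longleftrightarrow> (\<forall>t. poly q (\<phi> t) = 0)" using eq by simp
  also have "\<dots> \<longleftrightarrow> (\<forall>u. poly q u = 0)" using assms(1) by (metis surjD)
  finally show ?thesis by (simp add: poly_all_0_iff_0)
qed

text \<open>
  The induction step of Hoermander and Cohen. The sign pattern of \<open>P\<close> and \<open>G\<close> is determined by that
  of \<open>G\<close>, the derivative of \<open>P\<close>, and the remainders of \<open>P\<close> modulo these: at a root of a divisor, the
  value of \<open>P\<close> is the value of the remainder. If the derivative vanishes identically, \<open>P\<close> equals its
  constant coefficient, which is therefore added to the list.
\<close>

lemma sign_equivalent_extend:
  fixes P :: "'x \<Rightarrow> real poly"
  defines "P' \<equiv> \<lambda>x. pderiv (P x)"
  assumes finG: "finite G" 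
    and eqv: "sign_equivalent (G \<union> {P', \<lambda>x. [:coeff (P x) 0:]} \<union> remainder P ` insert P' G) x y"
  shows "sign_equivalent (insert P G) x y"
proof -
  obtain \<phi> where \<phi>: "order_auto \<phi>"
    and all': "\<forall>Q \<in> G \<union> {P', \<lambda>x. [:coeff (P x) 0:]} \<union> remainder P ` insert P' G.
      \<forall>t. sgn (poly (Q x) t) = sgn (poly (Q y) (\<phi> t))"
    using eqv unfolding sign_equivalent_def by (elim exE conjE)
  note all = all'[rule_format]
  have G: "sgn (poly (Q x) t) = sgn (poly (Q y) (\<phi> t))" if "Q \<in> G" for Q t
    using all that by blast
  have P': "sgn (poly (pderiv (P x)) t) = sgn (poly (pderiv (P y)) (\<phi> t))" for t
    using all[of P'] by (simp add: P'_def)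
  have c: "sgn (coeff (P x) 0) = sgn (coeff (P y) 0)"
    using all[of "\<lambda>x. [:coeff (P x) 0:]"] by simp
  have rem: "sgn (poly (remainder P Q x) t) = sgn (poly (remainder P Q y) (\<phi> t))" 
    if "Q \<in> insert P' G" for Q t
    using all that by blast
  have srj: "surj \<phi>" using \<phi> by (simp add: order_auto_def)
  have z': "pderiv (P x) = 0 \<longleftrightarrow> pderiv (P y) = 0"
    by (rule sgn_poly_all_zero[OF srj P'])
  have G': "sgn (poly (Q x) t) = sgn (poly (Q y) (\<phi> t))" if "Q \<in> insert P' G" for Q t
    using that G P' by (auto simp: P'_def)
  have zG: "Q x = 0 \<longleftrightarrow> Q y = 0" if "Q \<in> insert P' G" for Q
    by (rule sgn_poly_all_zero[OF srj G'[OF that]])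
  show ?thesis
  proof (cases "pderiv (P x) = 0")
    case True
    then have "degree (P x) = 0" "degree (P y) = 0" using z' by (auto simp: pderiv_eq_0_iff)
    then have "poly (P x) t = coeff (P x) 0" "poly (P y) u = coeff (P y) 0" for t u
      by (auto elim!: degree_eq_zeroE)
    then show ?thesis using \<phi> G c unfolding sign_equivalent_def by (intro exI[of _ \<phi>]) auto
  next
    case False
    define Z where "Z = (\<Union>Q\<in>insert P' G. if Q x = 0 then {} else {z. poly (Q x) z = 0})"
    have inZ: "z \<in> Z" if "Q \<in> insert P' G" "Q x \<noteq> 0" "poly (Q x) z = 0" for Q z
      using that unfolding Z_def by auto
    have Zimg: "u \<in> \<phi> ` Z" if "Q \<in> insert P' G" "Q y \<noteq> 0" "poly (Q y) u = 0" for Q u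
    proof -
      have "sgn (poly (Q x) (inv \<phi> u)) = sgn (poly (Q y) u)" 
        using G'[OF that(1), of "inv \<phi> u"] order_auto_inv(2)[OF \<phi>] by simp
      then have "poly (Q x) (inv \<phi> u) = 0" using that(3) by (simp add: sgn_zero_iff)
      then have "inv \<phi> u \<in> Z" using inZ that zG by blast
      then show ?thesis using order_auto_inv(2)[OF \<phi>] by (metis imageI)
    qed
    have "matched_pair Z \<phi> (P x) (P y)"
    proof
      show "finite Z" unfolding Z_def using finG by (auto simp: poly_roots_finite)
      show "order_auto \<phi>" by (rule \<phi>)
      show "z \<in> Z" if "poly (pderiv (P x)) z = 0" for z
        using inZ[of P' z] that False by (simp add: P'_def)
      show "sgn (poly (pderiv (P x)) t) = sgn (poly (pderiv (P y)) (\<phi> t))" for t by (rule P')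
      fix z assume "z \<in> Z"
      then obtain Q where Q: "Q \<in> insert P' G" "Q x \<noteq> 0" "poly (Q x) z = 0"
        unfolding Z_def by (auto split: if_splits)
      then have Qy: "Q y \<noteq> 0" "poly (Q y) (\<phi> z) = 0" 
        using zG[OF Q(1)] G'[OF Q(1), of z] by (simp_all add: sgn_zero_iff)
      show "sgn (poly (P x) z) = sgn (poly (P y) (\<phi> z))"
        using rem[OF Q(1), of z] poly_remainder[of Q x z P] poly_remainder[of Q y "\<phi> z" P] Q Qy by simp
    qed
    then obtain \<psi> where \<psi>: "order_auto \<psi>" "\<And>t. same_cell (\<phi> ` Z) (\<phi> t) (\<psi> t)" 
      "\<And>t. sgn (poly (P x) t) = sgn (poly (P y) (\<psi> t))"
      using matched_pair_adjust by blast
    have "sgn (poly (Q x) t) = sgn (poly (Q y) (\<psi> t))" if Q: "Q \<in> G" for Q t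
    proof (cases "Q y = 0")
      case True
      then show ?thesis using zG[of Q] Q by simp
    next
      case False
      then have "sgn (poly (Q y) (\<phi> t)) = sgn (poly (Q y) (\<psi> t))"
        using Zimg[of Q] Q by (intro poly_sgn_same_cell[OF \<psi>(2)]) auto
      then show ?thesis using G[OF Q] by simp
    qed
    then show ?thesis using \<psi>(1,3) unfolding sign_equivalent_def by (intro exI[of _ \<psi>]) auto
  qed
qed

section \<open>Families with coefficients that are piecewise fractions\<close>

locale function_ring =
  fixes R :: "('x \<Rightarrow> real) set"
  assumes const: "(\<lambda>x. c) \<in> R" 
    and add: "p \<in> R \<Longrightarrow> q \<in> R \<Longrightarrow> (\<lambda>x. p x + q x) \<in> R"
    and mult: "p \<in> R \<Longrightarrow> q \<in> R \<Longrightarrow> (\<lambda>x. p x * q x) \<in> R"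
begin

lemma constructible_UNIV: "UNIV \<in> constructible R"
proof -
  have "{x. (1::real) > 0} \<in> constructible R" by (rule constructible.pos[OF const])
  then show ?thesis by simp
qed

lemma constructible_empty: "{} \<in> constructible R"
  using constructible.compl[OF constructible_UNIV] by simp

lemma constructible_Union:
  assumes "finite \<A>" "\<A> \<subseteq> constructible R" shows "\<Union>\<A> \<in> constructible R"
  using assms by (induction \<A>) (auto intro: constructible_empty constructible.union)

lemma constructible_INT:
  assumes "finite I" "\<And>i. i \<in> I \<Longrightarrow> A i \<in> constructible R" shows "(\<Inter>i\<in>I. A i) \<in> constructible R"
  using assms by (induction I) (auto intro: constructible_UNIV constructible_inter)

lemma fractions_ring:
  assumes "p \<in> R" shows "p \<in> piecewise_fractions R"
  using piecewise_fractions.frac[OF assms const[of 1]] by simp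

lemma fractions_const: "(\<lambda>x. c) \<in> piecewise_fractions R"
  by (rule fractions_ring[OF const])

text \<open>
  An operation can be computed on the common refinement of the pieces, so only single fractions
  need to be considered.
\<close>

lemma fractions_binop:
  assumes op: "\<And>p q p' q'. p \<in> R \<Longrightarrow> q \<in> R \<Longrightarrow> p' \<in> R \<Longrightarrow> q' \<in> R \<Longrightarrow>
      (\<lambda>x. f (p x / q x) (p' x / q' x)) \<in> piecewise_fractions R"
    and "g \<in> piecewise_fractions R" "h \<in> piecewise_fractions R"
  shows "(\<lambda>x. f (g x) (h x)) \<in> piecewise_fractions R"
  using assms(2)
proof induction
  case (frac p q)
  show ?case using assms(3)
  proof induction
    case (frac p' q')
    then show ?case using op \<open>p \<in> R\<close> \<open>q \<in> R\<close> by blast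
  next
    case (glue g h A)
    have "(\<lambda>x. f (p x / q x) (if x \<in> A then g x else h x)) = 
      (\<lambda>x. if x \<in> A then f (p x / q x) (g x) else f (p x / q x) (h x))" by auto
    then show ?case using piecewise_fractions.glue[OF glue.IH glue.hyps(3)] by simp
  qed
next
  case (glue g h' A)
  have "(\<lambda>x. f (if x \<in> A then g x else h' x) (h x)) = 
    (\<lambda>x. if x \<in> A then f (g x) (h x) else f (h' x) (h x))" by auto
  then show ?case using piecewise_fractions.glue[OF glue.IH glue.hyps(3)] by simp
qed

lemma fractions_pos: 
  assumes "g \<in> piecewise_fractions R" shows "{x. g x > 0} \<in> constructible R"
  using assms
proof induction
  case (frac p q)
  have "{x. p x / q x > 0} = {x. p x * q x > 0}" by (simp add: zero_less_divide_iff zero_less_mult_iff)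
  then show ?case using constructible.pos[OF mult[OF frac]] by simp
next
  case (glue g h A)
  have "{x. (if x \<in> A then g x else h x) > 0} = (A \<inter> {x. g x > 0}) \<union> (- A \<inter> {x. h x > 0})" by auto
  then show ?case using glue by (simp add: constructible.intros constructible_inter)
qed

lemma fractions_mult:
  assumes "g \<in> piecewise_fractions R" "h \<in> piecewise_fractions R"
  shows "(\<lambda>x. g x * h x) \<in> piecewise_fractions R"
  using assms
proof (rule fractions_binop[rotated])
  fix p q p' q' assume "p \<in> R" "q \<in> R" "p' \<in> R" "q' \<in> R"
  then show "(\<lambda>x. p x / q x * (p' x / q' x)) \<in> piecewise_fractions R"
    using piecewise_fractions.frac[OF mult mult, of p p' q q'] by simp
qed

lemma fractions_divide:
  assumes "g \<in> piecewise_fractions R" "h \<in> piecewise_fractions R"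
  shows "(\<lambda>x. g x / h x) \<in> piecewise_fractions R"
  using assms
proof (rule fractions_binop[rotated])
  fix p q p' q' assume "p \<in> R" "q \<in> R" "p' \<in> R" "q' \<in> R"
  then show "(\<lambda>x. p x / q x / (p' x / q' x)) \<in> piecewise_fractions R"
    using piecewise_fractions.frac[OF mult mult, of p q' q p'] by simp
qed

lemma ring_zero_set: 
  assumes "p \<in> R" shows "{x. p x = 0} \<in> constructible R"
proof -
  have "{x. p x * p x > 0} \<in> constructible R" by (intro constructible.pos mult assms)
  moreover have "{x. p x = 0} = - {x. p x * p x > 0}" by (auto simp: zero_less_mult_iff)
  ultimately show ?thesis by (simp add: constructible.compl)
qed

lemma fractions_add:
  assumes "g \<in> piecewise_fractions R" "h \<in> piecewise_fractions R"
  shows "(\<lambda>x. g x + h x) \<in> piecewise_fractions R"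
  using assms
proof (rule fractions_binop[rotated])
  fix p q p' q' assume r: "p \<in> R" "q \<in> R" "p' \<in> R" "q' \<in> R"
  have "(\<lambda>x. p x / q x + p' x / q' x) = (\<lambda>x. if x \<in> {x. q x = 0} then p' x / q' x else
     if x \<in> {x. q' x = 0} then p x / q x else (p x * q' x + p' x * q x) / (q x * q' x))"
    by (auto simp: add_frac_eq)
  then show "(\<lambda>x. p x / q x + p' x / q' x) \<in> piecewise_fractions R"
    using r by (simp only:) (intro piecewise_fractions.intros add mult ring_zero_set)
qed

lemma fractions_uminus:
  assumes "g \<in> piecewise_fractions R" shows "(\<lambda>x. - g x) \<in> piecewise_fractions R"
  using fractions_mult[OF fractions_const[of "- 1"] assms] by simp

lemma fractions_diff:
  assumes "g \<in> piecewise_fractions R" "h \<in> piecewise_fractions R"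
  shows "(\<lambda>x. g x - h x) \<in> piecewise_fractions R"
  using fractions_add[OF assms(1) fractions_uminus[OF assms(2)]] by simp

lemma fractions_sum:
  assumes "\<And>i. i \<in> I \<Longrightarrow> g i \<in> piecewise_fractions R"
  shows "(\<lambda>x. \<Sum>i\<in>I. g i x) \<in> piecewise_fractions R"
  using assms 
  by (induction I rule: infinite_finite_induct) (auto intro: fractions_const fractions_add)

lemma fractions_zero_set: 
  assumes "g \<in> piecewise_fractions R" shows "{x. g x = 0} \<in> constructible R"
proof -
  have "{x. g x * g x > 0} \<in> constructible R" by (intro fractions_pos fractions_mult assms)
  moreover have "{x. g x = 0} = - {x. g x * g x > 0}" by (auto simp: zero_less_mult_iff)
  ultimately show ?thesis by (simp add: constructible.compl)
qed

definition poly_families :: "('x \<Rightarrow> real poly) set" where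
  "poly_families = {P. (\<exists>n. \<forall>x. \<forall>i\<ge>n. coeff (P x) i = 0) \<and> (\<forall>i. (\<lambda>x. coeff (P x) i) \<in> piecewise_fractions R)}"

lemma family_coeff: "P \<in> poly_families \<Longrightarrow> (\<lambda>x. coeff (P x) i) \<in> piecewise_fractions R"
  by (simp add: poly_families_def)

lemma family_bounded: 
  assumes "P \<in> poly_families" shows "\<exists>n. \<forall>x. \<forall>i\<ge>n. coeff (P x) i = 0"
  using assms by (simp add: poly_families_def)

lemma familyI:
  assumes "\<And>x i. n \<le> i \<Longrightarrow> coeff (P x) i = 0" "\<And>i. (\<lambda>x. coeff (P x) i) \<in> piecewise_fractions R"
  shows "P \<in> poly_families"
  using assms by (auto simp: poly_families_def)

lemma family_add:
  assumes "P \<in> poly_families" "Q \<in> poly_families" shows "(\<lambda>x. P x + Q x) \<in> poly_families"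
proof -
  obtain n where n: "\<And>x i. n \<le> i \<Longrightarrow> coeff (P x) i = 0" using family_bounded[OF assms(1)] by blast
  obtain m where m: "\<And>x i. m \<le> i \<Longrightarrow> coeff (Q x) i = 0" using family_bounded[OF assms(2)] by blast
  show ?thesis
    by (rule familyI[of "max n m"]) (simp_all add: n m fractions_add family_coeff assms)
qed

lemma family_diff:
  assumes "P \<in> poly_families" "Q \<in> poly_families" shows "(\<lambda>x. P x - Q x) \<in> poly_families"
proof -
  obtain n where n: "\<And>x i. n \<le> i \<Longrightarrow> coeff (P x) i = 0" using family_bounded[OF assms(1)] by blast
  obtain m where m: "\<And>x i. m \<le> i \<Longrightarrow> coeff (Q x) i = 0" using family_bounded[OF assms(2)] by blast
  show ?thesis
    by (rule familyI[of "max n m"]) (simp_all add: n m fractions_diff family_coeff assms)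
qed

lemma family_mult:
  assumes "P \<in> poly_families" "Q \<in> poly_families" shows "(\<lambda>x. P x * Q x) \<in> poly_families"
proof -
  obtain n where n: "\<And>x i. n \<le> i \<Longrightarrow> coeff (P x) i = 0" using family_bounded[OF assms(1)] by blast
  obtain m where m: "\<And>x i. m \<le> i \<Longrightarrow> coeff (Q x) i = 0" using family_bounded[OF assms(2)] by blast
  show ?thesis
  proof (rule familyI[of "n + m"])
    fix x i assume "n + m \<le> i"
    then have "n \<le> j \<or> m \<le> i - j" for j by linarith
    then show "coeff (P x * Q x) i = 0" 
      unfolding coeff_mult by (intro sum.neutral ballI) (metis n m mult_zero_left mult_zero_right)
  next
    fix i show "(\<lambda>x. coeff (P x * Q x) i) \<in> piecewise_fractions R"
      unfolding coeff_mult by (intro fractions_sum fractions_mult family_coeff assms)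
  qed
qed

lemma family_monom:
  assumes "g \<in> piecewise_fractions R" shows "(\<lambda>x. monom (g x) k) \<in> poly_families"
proof (rule familyI[of "Suc k"])
  fix i show "(\<lambda>x. coeff (monom (g x) k) i) \<in> piecewise_fractions R"
    using assms fractions_const[of 0] by (cases "i = k") auto
qed auto

lemma family_const:
  assumes "g \<in> piecewise_fractions R" shows "(\<lambda>x. [:g x:]) \<in> poly_families"
  using family_monom[OF assms, of 0] by (simp add: monom_0)

lemma family_zero: "(\<lambda>x. 0) \<in> poly_families"
  by (rule familyI) (auto intro: fractions_const)

lemma family_glue:
  assumes "P \<in> poly_families" "Q \<in> poly_families" "A \<in> constructible R" 
  shows "(\<lambda>x. if x \<in> A then P x else Q x) \<in> poly_families"
proof -
  obtain n where n: "\<And>x i. n \<le> i \<Longrightarrow> coeff (P x) i = 0" using family_bounded[OF assms(1)] by blast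
  obtain m where m: "\<And>x i. m \<le> i \<Longrightarrow> coeff (Q x) i = 0" using family_bounded[OF assms(2)] by blast
  show ?thesis
  proof (rule familyI[of "max n m"])
    fix i 
    have "(\<lambda>x. if x \<in> A then coeff (P x) i else coeff (Q x) i) \<in> piecewise_fractions R"
      by (intro piecewise_fractions.glue family_coeff assms)
    then show "(\<lambda>x. coeff (if x \<in> A then P x else Q x) i) \<in> piecewise_fractions R"
      by (simp add: if_distrib[of "\<lambda>p. coeff p i"])
  qed (auto simp: n m)
qed

lemma family_sum:
  assumes "\<And>i. i \<in> I \<Longrightarrow> P i \<in> poly_families"
  shows "(\<lambda>x. \<Sum>i\<in>I. P i x) \<in> poly_families"
  using assms 
  by (induction I rule: infinite_finite_induct) (auto intro: family_zero family_add)

lemma family_pderiv: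
  assumes "P \<in> poly_families" shows "(\<lambda>x. pderiv (P x)) \<in> poly_families"
proof -
  obtain n where n: "\<And>x i. n \<le> i \<Longrightarrow> coeff (P x) i = 0" using family_bounded[OF assms(1)] by blast
  show ?thesis
    by (rule familyI[of n]) 
      (auto simp: coeff_pderiv n simp del: of_nat_Suc intro!: fractions_mult fractions_const family_coeff assms)
qed

lemma family_degree_stratum:
  assumes "Q \<in> poly_families" shows "{x. Q x \<noteq> 0 \<and> degree (Q x) = k} \<in> constructible R"
proof -
  obtain n where n: "\<And>x i. n \<le> i \<Longrightarrow> coeff (Q x) i = 0" using family_bounded[OF assms(1)] by blast
  have "{x. Q x \<noteq> 0 \<and> degree (Q x) = k} = - {x. coeff (Q x) k = 0} \<inter> (\<Inter>i\<in>{k<..n}. {x. coeff (Q x) i = 0})"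
  proof (intro equalityI subsetI)
    fix x assume x: "x \<in> - {x. coeff (Q x) k = 0} \<inter> (\<Inter>i\<in>{k<..n}. {x. coeff (Q x) i = 0})"
    have "degree (Q x) \<le> k"
    proof (rule degree_le, intro allI impI)
      fix i assume "k < i"
      then show "coeff (Q x) i = 0" using x n[of i x] by (cases "i \<le> n") auto
    qed
    moreover have "k \<le> degree (Q x)" using x by (intro le_degree) auto
    ultimately show "x \<in> {x. Q x \<noteq> 0 \<and> degree (Q x) = k}" using x by auto
  next
    fix x assume "x \<in> {x. Q x \<noteq> 0 \<and> degree (Q x) = k}"
    then show "x \<in> - {x. coeff (Q x) k = 0} \<inter> (\<Inter>i\<in>{k<..n}. {x. coeff (Q x) i = 0})"
      by (auto simp: coeff_eq_0 leading_coeff_0_iff)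
  qed
  then show ?thesis
    by (simp only:) (intro constructible_inter constructible.compl constructible_INT fractions_zero_set family_coeff assms finite_greaterThanAtMost)
qed

text \<open>
  Where the divisor has degree exactly \<open>k\<close>, the leading term of \<open>P\<close> is cancelled as in ordinary
  long division; the induction is on a bound for the degree of \<open>P\<close>.
\<close>

lemma family_mod_stratum:
  assumes Q: "Q \<in> poly_families" and "P \<in> poly_families" and "\<And>x i. n \<le> i \<Longrightarrow> coeff (P x) i = 0"
  shows "(\<lambda>x. if x \<in> {x. Q x \<noteq> 0 \<and> degree (Q x) = k} then P x mod Q x else 0) \<in> poly_families"
  using assms(2,3)
proof (induction n arbitrary: P)
  case 0
  then have "P x = 0" for x by (simp add: poly_eq_iff)
  then have "(\<lambda>x. if x \<in> {x. Q x \<noteq> 0 \<and> degree (Q x) = k} then P x mod Q x else 0) = (\<lambda>x. 0)" by auto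
  then show ?case using family_zero by simp
next
  case (Suc n)
  let ?A = "{x. Q x \<noteq> 0 \<and> degree (Q x) = k}"
  have A: "?A \<in> constructible R" by (rule family_degree_stratum[OF Q])
  show ?case
  proof (cases "n < k")
    case True
    have "degree (P x) \<le> n" for x using Suc.prems(2) by (intro degree_le) (auto simp: Suc_le_eq)
    then have "P x mod Q x = P x" if "degree (Q x) = k" for x
      using that True by (intro mod_poly_less) (auto intro: le_less_trans)
    then have "(\<lambda>x. if x \<in> ?A then P x mod Q x else 0) = (\<lambda>x. if x \<in> ?A then P x else 0)" by auto
    then show ?thesis using family_glue[OF Suc.prems(1) family_zero A] by simp
  next
    case False
    define S where "S x = monom (coeff (P x) n / coeff (Q x) k) (n - k) * Q x" for x
    define P1 where "P1 = (\<lambda>x. if x \<in> ?A then P x - S x else 0)"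
    have "P1 \<in> poly_families" unfolding P1_def S_def
      by (intro family_glue family_diff family_mult family_monom fractions_divide family_coeff Suc.prems Q A family_zero)
    moreover have "coeff (P1 x) i = 0" if "n \<le> i" for x i
    proof (cases "x \<in> ?A")
      case x: True
      then have c: "coeff (Q x) k \<noteq> 0" by auto
      have S: "coeff (S x) i = coeff (P x) n / coeff (Q x) k * coeff (Q x) (i - (n - k))"
        using that by (simp add: S_def coeff_monom_mult)
      show ?thesis
      proof (cases "i = n")
        case True
        then show ?thesis using x c S False by (simp add: P1_def)
      next
        case ne: False
        then have "k < i - (n - k)" using that False by linarith
        then have "coeff (Q x) (i - (n - k)) = 0" using x by (intro coeff_eq_0) auto
        moreover have "coeff (P x) i = 0" using Suc.prems(2) ne that by simp
        ultimately show ?thesis using x S by (simp add: P1_def)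
      qed
    qed (auto simp: P1_def)
    ultimately have "(\<lambda>x. if x \<in> ?A then P1 x mod Q x else 0) \<in> poly_families"
      by (rule Suc.IH)
    moreover have "P1 x mod Q x = P x mod Q x" if "x \<in> ?A" for x
    proof -
      have "P x = P1 x + monom (coeff (P x) n / coeff (Q x) k) (n - k) * Q x" using that by (simp add: P1_def S_def)
      then show ?thesis by (metis mod_mult_self3 add.commute)
    qed
    then have "(\<lambda>x. if x \<in> ?A then P1 x mod Q x else 0) = (\<lambda>x. if x \<in> ?A then P x mod Q x else 0)" by auto
    ultimately show ?thesis by simp
  qed
qed

lemma family_remainder:
  assumes P: "P \<in> poly_families" and Q: "Q \<in> poly_families" 
  shows "remainder P Q \<in> poly_families"
proof -
  obtain n where n: "\<And>x i. n \<le> i \<Longrightarrow> coeff (P x) i = 0" using family_bounded[OF P] by blast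
  obtain m where m: "\<And>x i. m \<le> i \<Longrightarrow> coeff (Q x) i = 0" using family_bounded[OF Q] by blast
  have "remainder P Q = (\<lambda>x. \<Sum>k\<le>m. if x \<in> {x. Q x \<noteq> 0 \<and> degree (Q x) = k} then P x mod Q x else 0)"
  proof
    fix x
    have "degree (Q x) \<le> m" using m by (intro degree_le) auto
    then show "remainder P Q x = (\<Sum>k\<le>m. if x \<in> {x. Q x \<noteq> 0 \<and> degree (Q x) = k} then P x mod Q x else 0)"
      by (simp add: remainder_def)
  qed
  then show ?thesis
    using family_mod_stratum[OF Q P n] by (simp only:) (intro family_sum)
qed

section \<open>Stratification of the parameter space and projection\<close>

text \<open>
  The finitely many constructible pieces may overlap; a cover is as good as a partition here.
\<close>

definition stratified :: "('x \<Rightarrow> 'x \<Rightarrow> bool) \<Rightarrow> bool" where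
  "stratified r \<longleftrightarrow> (\<exists>\<C>. finite \<C> \<and> \<C> \<subseteq> constructible R \<and> \<Union>\<C> = UNIV \<and> (\<forall>C\<in>\<C>. \<forall>x\<in>C. \<forall>y\<in>C. r x y))"

lemma stratified_mono: 
  assumes "stratified r" and rs: "\<And>x y. r x y \<Longrightarrow> s x y" shows "stratified s"
proof -
  from assms(1) obtain \<C> where C: "finite \<C>" "\<C> \<subseteq> constructible R" "\<Union>\<C> = UNIV" 
    "\<forall>C\<in>\<C>. \<forall>x\<in>C. \<forall>y\<in>C. r x y"
    unfolding stratified_def by (elim exE conjE)
  have "\<forall>C\<in>\<C>. \<forall>x\<in>C. \<forall>y\<in>C. s x y" using C(4) rs by simp
  with C(1-3) show ?thesis unfolding stratified_def by (intro exI[of _ \<C>] conjI)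
qed

lemma stratified_conj:
  assumes "stratified r" "stratified s" shows "stratified (\<lambda>x y. r x y \<and> s x y)"
proof -
  from assms(1) obtain \<C> where C: "finite \<C>" "\<C> \<subseteq> constructible R" "\<Union>\<C> = UNIV" 
    "\<forall>C\<in>\<C>. \<forall>x\<in>C. \<forall>y\<in>C. r x y"
    unfolding stratified_def by (elim exE conjE)
  from assms(2) obtain \<D> where D: "finite \<D>" "\<D> \<subseteq> constructible R" "\<Union>\<D> = UNIV" 
    "\<forall>C\<in>\<D>. \<forall>x\<in>C. \<forall>y\<in>C. s x y"
    unfolding stratified_def by (elim exE conjE)
  let ?E = "(\<lambda>(C, D). C \<inter> D) ` (\<C> \<times> \<D>)"
  show ?thesis unfolding stratified_def
  proof (intro exI[of _ ?E] conjI)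
    show "finite ?E" using C D by simp
    show "?E \<subseteq> constructible R" using C(2) D(2) by (auto intro: constructible_inter)
    show "\<Union>?E = UNIV"
    proof (intro equalityI subsetI UNIV_I)
      fix x
      obtain A B where "A \<in> \<C>" "x \<in> A" "B \<in> \<D>" "x \<in> B" using C(3) D(3) by (metis UNIV_I UnionE)
      then show "x \<in> \<Union>?E" by auto
    qed
    show "\<forall>C\<in>?E. \<forall>x\<in>C. \<forall>y\<in>C. r x y \<and> s x y" using C(4) D(4) by auto
  qed
qed

lemma stratified_sgn:
  assumes g: "g \<in> piecewise_fractions R" shows "stratified (\<lambda>x y. sgn (g x) = sgn (g y))"
  unfolding stratified_def
proof (intro exI[of _ "{{x. g x > 0}, {x. g x = 0}, {x. - g x > 0}}"] conjI)
  show "{{x. g x > 0}, {x. g x = 0}, {x. - g x > 0}} \<subseteq> constructible R"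
    using fractions_pos[OF g] fractions_zero_set[OF g] fractions_pos[OF fractions_uminus[OF g]] by simp
qed auto

lemma stratified_sgns:
  assumes "finite F" "\<And>P. P \<in> F \<Longrightarrow> (\<lambda>x. coeff (P x) 0) \<in> piecewise_fractions R" 
  shows "stratified (\<lambda>x y. \<forall>P\<in>F. sgn (coeff (P x) 0) = sgn (coeff (P y) 0))"
  using assms
proof (induction F)
  case empty
  show ?case unfolding stratified_def by (intro exI[of _ "{UNIV}"]) (auto intro: constructible_UNIV)
next
  case (insert P F)
  then show ?case using stratified_conj[OF stratified_sgn[of "\<lambda>x. coeff (P x) 0"] insert.IH] by simp
qed

text \<open>
  Finitely many sign patterns occur, each on a constructible set of parameters. The outer induction is
  on a bound for the degrees, the inner one on the set \<open>H\<close> of the families that may attain the bound: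
  replacing one of them by its derivative and remainders produces only families of degree below the bound.
\<close>

theorem stratified_sign_equivalent:
  assumes "finite F" "F \<subseteq> poly_families" "\<And>P x. P \<in> F \<Longrightarrow> degree (P x) \<le> d"
  shows "stratified (sign_equivalent F)"
  using assms
proof (induction d arbitrary: F)
  case 0
  have "stratified (\<lambda>x y. \<forall>P\<in>F. sgn (coeff (P x) 0) = sgn (coeff (P y) 0))"
    using 0 family_coeff by (intro stratified_sgns) auto
  moreover have "sign_equivalent F x y" if s: "\<forall>P\<in>F. sgn (coeff (P x) 0) = sgn (coeff (P y) 0)" for x y
  proof -
    have "poly (P x) t = coeff (P x) 0" if "P \<in> F" for P x t
    proof -
      have "degree (P x) = 0" using 0(3)[OF that] by simp
      then show ?thesis by (auto elim: degree_eq_zeroE)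
    qed
    then show ?thesis using s unfolding sign_equivalent_def by (intro exI[of _ "\<lambda>t. t"]) simp
  qed
  ultimately show ?case by (rule stratified_mono)
next
  case (Suc d)
  have "stratified (sign_equivalent (G \<union> H))"
    if "finite H" "H \<subseteq> poly_families" "\<And>P x. P \<in> H \<Longrightarrow> degree (P x) \<le> Suc d"
      "finite G" "G \<subseteq> poly_families" "\<And>P x. P \<in> G \<Longrightarrow> degree (P x) \<le> d" for G H
    using that
  proof (induction H arbitrary: G)
    case empty
    then show ?case using Suc.IH by simp
  next
    case (insert P H)
    let ?P' = "\<lambda>x. pderiv (P x)"
    let ?L = "G \<union> {?P', \<lambda>x. [:coeff (P x) 0:]} \<union> remainder P ` insert ?P' (G \<union> H)"
    have P: "P \<in> poly_families" using insert.prems by simp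
    have P': "?P' \<in> poly_families" by (rule family_pderiv[OF P])
    have degP': "degree (?P' x) \<le> d" for x
      using insert.prems(2)[of P x] by (simp add: degree_pderiv)
    have "stratified (sign_equivalent (?L \<union> H))"
    proof (rule insert.IH)
      show "finite ?L" using insert by simp
      show "?L \<subseteq> poly_families" 
        using insert.prems P P' by (auto intro!: family_const family_coeff family_remainder)
      fix Q x assume "Q \<in> ?L"
      then consider "Q \<in> G" | "Q = ?P'" | "Q = (\<lambda>x. [:coeff (P x) 0:])" 
        | S where "S \<in> insert ?P' (G \<union> H)" "Q = remainder P S" by blast
      then show "degree (Q x) \<le> d"
      proof cases
        case 4
        have "degree (S x) \<le> Suc d" using 4 insert.prems(2,5)[of S x] degP'[of x] by (auto intro: le_SucI)
        then show ?thesis using degree_mod_less[of "S x" "P x"] 4 by (auto simp: remainder_def)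
      qed (use insert.prems degP' in auto)
    qed (use insert.prems in auto)
    then have "stratified (sign_equivalent (insert P (G \<union> H)))"
    proof (rule stratified_mono)
      fix x y assume *: "sign_equivalent (?L \<union> H) x y"
      have "(G \<union> H) \<union> {?P', \<lambda>x. [:coeff (P x) 0:]} \<union> remainder P ` insert ?P' (G \<union> H) = ?L \<union> H" by blast
      then show "sign_equivalent (insert P (G \<union> H)) x y"
        using * insert by (intro sign_equivalent_extend) simp_all
    qed
    then show ?case by simp
  qed
  from this[of F "{}"] Suc.prems show ?case by simp
qed

text \<open>
  The Tarski-Seidenberg theorem in abstract form: sign-equivalent parameters have fibres that are
  both empty or both nonempty, so the projection is a union of pieces of a stratification.
\<close>

theorem constructible_projection:
  assumes "A \<in> constructible {\<lambda>z. poly (P (fst z)) (snd z) | P. P \<in> poly_families}"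
  shows "{x. \<exists>t. (x, t) \<in> A} \<in> constructible R"
proof -
  have "\<exists>F. finite F \<and> F \<subseteq> poly_families \<and> (\<forall>x t y u. 
    (\<forall>P\<in>F. sgn (poly (P x) t) = sgn (poly (P y) u)) \<longrightarrow> ((x, t) \<in> A \<longleftrightarrow> (y, u) \<in> A))"
    using assms
  proof induction
    case (pos p)
    then obtain P where P: "P \<in> poly_families" "p = (\<lambda>z. poly (P (fst z)) (snd z))" by blast
    have pos: "a > 0 \<longleftrightarrow> b > 0" if "sgn a = sgn b" for a b :: real
      using that by (metis sgn_greater)
    show ?case
    proof (intro exI[of _ "{P}"] conjI allI impI)
      fix x t y u assume "\<forall>P\<in>{P}. sgn (poly (P x) t) = sgn (poly (P y) u)"
      then show "(x, t) \<in> {x. p x > 0} \<longleftrightarrow> (y, u) \<in> {x. p x > 0}"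
        using pos[of "poly (P x) t" "poly (P y) u"] P(2) by simp
    qed (use P(1) in auto)
  next
    case (compl A)
    then show ?case by simp
  next
    case (union A B)
    from union.IH(1) obtain F where F: "finite F" "F \<subseteq> poly_families" "\<forall>x t y u. 
      (\<forall>P\<in>F. sgn (poly (P x) t) = sgn (poly (P y) u)) \<longrightarrow> ((x, t) \<in> A \<longleftrightarrow> (y, u) \<in> A)"
      by (elim exE conjE)
    from union.IH(2) obtain G where G: "finite G" "G \<subseteq> poly_families" "\<forall>x t y u. 
      (\<forall>P\<in>G. sgn (poly (P x) t) = sgn (poly (P y) u)) \<longrightarrow> ((x, t) \<in> B \<longleftrightarrow> (y, u) \<in> B)"
      by (elim exE conjE)
    show ?case
    proof (intro exI[of _ "F \<union> G"] conjI allI impI)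
      fix x t y u assume "\<forall>P\<in>F \<union> G. sgn (poly (P x) t) = sgn (poly (P y) u)"
      then show "((x, t) \<in> A \<union> B) = ((y, u) \<in> A \<union> B)"
        using F(3)[rule_format, of x t y u] G(3)[rule_format, of x t y u] by simp
    qed (use F G in auto)
  qed
  then obtain F where F: "finite F" "F \<subseteq> poly_families" "\<forall>x t y u. 
      (\<forall>P\<in>F. sgn (poly (P x) t) = sgn (poly (P y) u)) \<longrightarrow> ((x, t) \<in> A \<longleftrightarrow> (y, u) \<in> A)"
    by (elim exE conjE)
  have "\<exists>d. \<forall>P\<in>F. \<forall>x. degree (P x) \<le> d"
    using F(1,2)
  proof (induction F)
    case (insert P F)
    then obtain d where d: "\<forall>P\<in>F. \<forall>x. degree (P x) \<le> d" by auto
    obtain n where "\<And>x i. n \<le> i \<Longrightarrow> coeff (P x) i = 0" 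
      using family_bounded[of P] insert.prems by auto
    then have "degree (P x) \<le> n" for x by (intro degree_le) auto
    then show ?case using d by (intro exI[of _ "max d n"]) (auto simp: le_max_iff_disj)
  qed simp
  then obtain d where "\<forall>P\<in>F. \<forall>x. degree (P x) \<le> d" ..
  then have "stratified (sign_equivalent F)" 
    using stratified_sign_equivalent[OF F(1,2), of d] by simp
  then obtain \<C> where C: "finite \<C>" "\<C> \<subseteq> constructible R" "\<Union>\<C> = UNIV" 
    "\<forall>C\<in>\<C>. \<forall>x\<in>C. \<forall>y\<in>C. sign_equivalent F x y"
    unfolding stratified_def by (elim exE conjE)
  have inv: "\<exists>u. (y, u) \<in> A" if eqv: "sign_equivalent F x y" and xA: "(x, t) \<in> A" for x y t
  proof -
    obtain \<phi> where "order_auto \<phi>" "\<forall>P\<in>F. \<forall>t. sgn (poly (P x) t) = sgn (poly (P y) (\<phi> t))"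
      using eqv unfolding sign_equivalent_def by (elim exE conjE)
    then have "(y, \<phi> t) \<in> A" using F(3)[rule_format, of x t y "\<phi> t"] xA by blast
    then show ?thesis ..
  qed
  have "{x. \<exists>t. (x, t) \<in> A} = \<Union>{C\<in>\<C>. \<exists>x\<in>C. \<exists>t. (x, t) \<in> A}"
  proof (intro equalityI subsetI)
    fix x assume "x \<in> {x. \<exists>t. (x, t) \<in> A}"
    moreover obtain C where "C \<in> \<C>" "x \<in> C" using C(3) by (metis UNIV_I UnionE)
    ultimately show "x \<in> \<Union>{C\<in>\<C>. \<exists>x\<in>C. \<exists>t. (x, t) \<in> A}" by blast
  next
    fix y assume "y \<in> \<Union>{C\<in>\<C>. \<exists>x\<in>C. \<exists>t. (x, t) \<in> A}"
    then show "y \<in> {x. \<exists>t. (x, t) \<in> A}" using C(4) inv by blast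
  qed
  moreover have "\<Union>{C\<in>\<C>. \<exists>x\<in>C. \<exists>t. (x, t) \<in> A} \<in> constructible R"
    by (rule constructible_Union) (use C in auto)
  ultimately show ?thesis by simp
qed

end

section \<open>Elimination of coordinates\<close>

inductive_set coordinate_polynomials :: "nat \<Rightarrow> ((nat \<Rightarrow> real) \<Rightarrow> real) set" for k where
  const: "(\<lambda>w. c) \<in> coordinate_polynomials k"
| var: "i < k \<Longrightarrow> (\<lambda>w. w i) \<in> coordinate_polynomials k"
| add: "p \<in> coordinate_polynomials k \<Longrightarrow> q \<in> coordinate_polynomials k \<Longrightarrow> (\<lambda>w. p w + q w) \<in> coordinate_polynomials k"
| mult: "p \<in> coordinate_polynomials k \<Longrightarrow> q \<in> coordinate_polynomials k \<Longrightarrow> (\<lambda>w. p w * q w) \<in> coordinate_polynomials k"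

text \<open>
  Polynomials in a vector \<open>y\<close> of a Euclidean space and the first \<open>k\<close> coordinates of a sequence.
  The sequence has room for any number of variables, so that their elimination is an induction
  within a single type.
\<close>

inductive_set mixed_polynomials :: "nat \<Rightarrow> ('a::euclidean_space \<times> (nat \<Rightarrow> real) \<Rightarrow> real) set" for k where
  linear: "bounded_linear g \<Longrightarrow> (\<lambda>z. g (fst z)) \<in> mixed_polynomials k"
| const: "(\<lambda>z. c) \<in> mixed_polynomials k"
| var: "i < k \<Longrightarrow> (\<lambda>z. snd z i) \<in> mixed_polynomials k"
| add: "p \<in> mixed_polynomials k \<Longrightarrow> q \<in> mixed_polynomials k \<Longrightarrow> (\<lambda>z. p z + q z) \<in> mixed_polynomials k"
| mult: "p \<in> mixed_polynomials k \<Longrightarrow> q \<in> mixed_polynomials k \<Longrightarrow> (\<lambda>z. p z * q z) \<in> mixed_polynomials k"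

lemma coordinate_polynomials_mixed:
  "p \<in> coordinate_polynomials k \<Longrightarrow> (\<lambda>z. p (snd z)) \<in> mixed_polynomials k"
  by (induction rule: coordinate_polynomials.induct) (auto intro: mixed_polynomials.intros)

interpretation mixed: function_ring "mixed_polynomials k" for k
  by unfold_locales (auto intro: mixed_polynomials.intros)

lemma constructible_vimage:
  assumes "A \<in> constructible R" and "\<And>p. p \<in> R \<Longrightarrow> (\<lambda>x. p (f x)) \<in> R'"
  shows "f -` A \<in> constructible R'"
  using assms(1)
proof induction
  case (pos p)
  then show ?case using constructible.pos[OF assms(2)[OF pos]] by (simp add: vimage_def)
qed (simp_all add: vimage_Compl constructible.intros)

lemma mixed_polynomial_last_variable:
  assumes "p \<in> mixed_polynomials (Suc k)"
  shows "\<exists>P\<in>mixed.poly_families k. \<forall>z t. p (fst z, (snd z)(k := t)) = poly (P z) t"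
  using assms
proof induction
  case (linear g)
  then show ?case
    by (intro bexI[of _ "\<lambda>z. [:g (fst z):]"] mixed.family_const mixed.fractions_ring) 
      (auto intro: mixed_polynomials.linear)
next
  case (const c)
  show ?case
    by (intro bexI[of _ "\<lambda>z. [:c:]"] mixed.family_const mixed.fractions_const) auto
next
  case (var i)
  show ?case
  proof (cases "i = k")
    case True
    then show ?thesis
      by (intro bexI[of _ "\<lambda>z. monom 1 1"] mixed.family_monom mixed.fractions_const) (auto simp: poly_monom)
  next
    case False
    then show ?thesis using var
      by (intro bexI[of _ "\<lambda>z. [:snd z i:]"] mixed.family_const mixed.fractions_ring mixed_polynomials.var) auto
  qed
next
  case (add p q)
  from add.IH(1) obtain P where "P \<in> mixed.poly_families k" "\<forall>z t. p (fst z, (snd z)(k := t)) = poly (P z) t" ..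
  moreover from add.IH(2) obtain Q where 
    "Q \<in> mixed.poly_families k" "\<forall>z t. q (fst z, (snd z)(k := t)) = poly (Q z) t" ..
  ultimately show ?case by (intro bexI[of _ "\<lambda>z. P z + Q z"] mixed.family_add allI) (simp_all only: poly_add)
next
  case (mult p q)
  from mult.IH(1) obtain P where "P \<in> mixed.poly_families k" "\<forall>z t. p (fst z, (snd z)(k := t)) = poly (P z) t" ..
  moreover from mult.IH(2) obtain Q where 
    "Q \<in> mixed.poly_families k" "\<forall>z t. q (fst z, (snd z)(k := t)) = poly (Q z) t" ..
  ultimately show ?case by (intro bexI[of _ "\<lambda>z. P z * Q z"] mixed.family_mult allI) (simp_all only: poly_mult)
qed

lemma eliminate_last_variable:
  fixes A :: "('a::euclidean_space \<times> (nat \<Rightarrow> real)) set"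
  assumes "A \<in> constructible (mixed_polynomials (Suc k))"
  shows "{z. \<exists>t. (fst z, (snd z)(k := t)) \<in> A} \<in> constructible (mixed_polynomials k)"
proof -
  let ?f = "\<lambda>(z :: 'a \<times> (nat \<Rightarrow> real), t). (fst z, (snd z)(k := t))"
  have "?f -` A \<in> constructible {\<lambda>z. poly (P (fst z)) (snd z) | P. P \<in> mixed.poly_families k}"
  proof (rule constructible_vimage[OF assms])
    fix p :: "'a \<times> (nat \<Rightarrow> real) \<Rightarrow> real" assume "p \<in> mixed_polynomials (Suc k)"
    from mixed_polynomial_last_variable[OF this] obtain P 
      where P: "P \<in> mixed.poly_families k" "\<forall>z t. p (fst z, (snd z)(k := t)) = poly (P z) t" ..
    then have "(\<lambda>x. p (?f x)) = (\<lambda>z. poly (P (fst z)) (snd z))" by auto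
    then show "(\<lambda>x. p (?f x)) \<in> {\<lambda>z. poly (P (fst z)) (snd z) | P. P \<in> mixed.poly_families k}"
      using P(1) by blast
  qed
  from mixed.constructible_projection[OF this] show ?thesis by simp
qed

lemma eliminate_all_variables:
  fixes A :: "('a::euclidean_space \<times> (nat \<Rightarrow> real)) set"
  assumes "A \<in> constructible (mixed_polynomials k)"
  shows "{z. \<exists>w. (fst z, \<lambda>i. if i < k then w i else snd z i) \<in> A} \<in> constructible (mixed_polynomials 0)"
  using assms
proof (induction k arbitrary: A)
  case 0
  then show ?case by simp
next
  case (Suc k)
  let ?A = "{z. \<exists>t. (fst z, (snd z)(k := t)) \<in> A}"
  have "{z. \<exists>w. (fst z, \<lambda>i. if i < Suc k then w i else snd z i) \<in> A} = 
    {z. \<exists>w. (fst z, \<lambda>i. if i < k then w i else snd z i) \<in> ?A}"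
  proof (intro Collect_cong iffI)
    fix z assume "\<exists>w. (fst z, \<lambda>i. if i < Suc k then w i else snd z i) \<in> A"
    then obtain w where w: "(fst z, \<lambda>i. if i < Suc k then w i else snd z i) \<in> A" ..
    have "(\<lambda>i. if i < Suc k then w i else snd z i) = (\<lambda>i. if i < k then w i else snd z i)(k := w k)" by auto
    with w show "\<exists>w. (fst z, \<lambda>i. if i < k then w i else snd z i) \<in> ?A" by auto
  next
    fix z assume "\<exists>w. (fst z, \<lambda>i. if i < k then w i else snd z i) \<in> ?A"
    then obtain w t where w: "(fst z, (\<lambda>i. if i < k then w i else snd z i)(k := t)) \<in> A" by auto
    have "(\<lambda>i. if i < k then w i else snd z i)(k := t) = (\<lambda>i. if i < Suc k then (w(k := t)) i else snd z i)" by auto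
    with w show "\<exists>w. (fst z, \<lambda>i. if i < Suc k then w i else snd z i) \<in> A" by metis
  qed
  then show ?case using Suc.IH[OF eliminate_last_variable[OF Suc.prems]] by simp
qed

lemma mixed_polynomials_0:
  "p \<in> mixed_polynomials 0 \<Longrightarrow> real_polynomial_function (\<lambda>y. p (y, w))"
  by (induction rule: mixed_polynomials.induct) auto

lemma semialgebraic_constructible:
  assumes "A \<in> constructible {p. real_polynomial_function p}" shows "semialgebraic A"
  using assms by induction (auto intro: semialgebraic.intros)

theorem semialgebraic_exists:
  fixes A :: "('a::euclidean_space \<times> (nat \<Rightarrow> real)) set"
  assumes "A \<in> constructible (mixed_polynomials k)"
  shows "semialgebraic {y. \<exists>w. (\<forall>i\<ge>k. w i = 0) \<and> (y, w) \<in> A}"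
proof -
  have "(\<lambda>y. (y, \<lambda>i. 0)) -` {z. \<exists>w. (fst z, \<lambda>i. if i < k then w i else snd z i) \<in> A}
      \<in> constructible {p :: 'a \<Rightarrow> real. real_polynomial_function p}"
    by (rule constructible_vimage[OF eliminate_all_variables[OF assms]]) (simp add: mixed_polynomials_0)
  moreover have "(\<lambda>y. (y, \<lambda>i. 0)) -` {z. \<exists>w. (fst z, \<lambda>i. if i < k then w i else snd z i) \<in> A} = 
    {y. \<exists>w. (\<forall>i\<ge>k. w i = 0) \<and> (y, w) \<in> A}"
  proof (intro equalityI subsetI)
    fix y assume "y \<in> {y. \<exists>w. (\<forall>i\<ge>k. w i = 0) \<and> (y, w) \<in> A}"
    then obtain w where w: "\<forall>i\<ge>k. w i = 0" "(y, w) \<in> A" by blast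
    then have "(\<lambda>i. if i < k then w i else 0) = w" by (auto simp: fun_eq_iff)
    with w(2) show "y \<in> (\<lambda>y. (y, \<lambda>i. 0)) -` {z. \<exists>w. (fst z, \<lambda>i. if i < k then w i else snd z i) \<in> A}"
      by (simp only: vimage_eq mem_Collect_eq fst_conv snd_conv) (rule exI[of _ w], simp)
  next
    fix y assume "y \<in> (\<lambda>y. (y, \<lambda>i. 0)) -` {z. \<exists>w. (fst z, \<lambda>i. if i < k then w i else snd z i) \<in> A}"
    then obtain w where "(y, \<lambda>i. if i < k then w i else 0) \<in> A" by (auto cong: if_cong)
    then show "y \<in> {y. \<exists>w. (\<forall>i\<ge>k. w i = 0) \<and> (y, w) \<in> A}" 
      by (intro CollectI exI[of _ "\<lambda>i. if i < k then w i else 0"]) auto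
  qed
  ultimately show ?thesis by (simp add: semialgebraic_constructible)
qed

lemma coordinate_polynomials_sum:
  assumes "\<And>i. i \<in> I \<Longrightarrow> p i \<in> coordinate_polynomials k"
  shows "(\<lambda>w. \<Sum>i\<in>I. p i w) \<in> coordinate_polynomials k"
  using assms by (induction I rule: infinite_finite_induct) (auto intro: coordinate_polynomials.intros)

lemma coordinate_polynomials_power:
  assumes "p \<in> coordinate_polynomials k"
  shows "(\<lambda>w. p w ^ n) \<in> coordinate_polynomials k"
  using assms by (induction n) (auto intro: coordinate_polynomials.intros)

lemma coordinate_polynomials_diff:
  assumes "p \<in> coordinate_polynomials k" "q \<in> coordinate_polynomials k"
  shows "(\<lambda>w. p w - q w) \<in> coordinate_polynomials k"
proof -
  have "(\<lambda>w. p w + (- 1) * q w) \<in> coordinate_polynomials k"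
    by (intro coordinate_polynomials.intros assms)
  then show ?thesis by simp
qed

text \<open>
  The graph relation \<open>y = F w\<close>, together with the inequality for the ball, is constructible; the image
  arises by eliminating \<open>w\<close>.
\<close>

theorem semialgebraic_polynomial_image_ball:
  fixes F :: "(nat \<Rightarrow> real) \<Rightarrow> 'a::euclidean_space"
  assumes "\<And>b. b \<in> Basis \<Longrightarrow> (\<lambda>w. F w \<bullet> b) \<in> coordinate_polynomials k"
  shows "semialgebraic (F ` closed_unit_ball k)"
proof -
  define A :: "('a \<times> (nat \<Rightarrow> real)) set" where 
    "A = - {z. (\<Sum>i<k. (snd z i)\<^sup>2) - 1 > 0} \<inter> (\<Inter>b\<in>Basis. {z. F (snd z) \<bullet> b + - 1 * (fst z \<bullet> b) = 0})"
  have "(\<lambda>w. (\<Sum>i<k. (w i)\<^sup>2) - 1) \<in> coordinate_polynomials k"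
    by (intro coordinate_polynomials_diff coordinate_polynomials_sum coordinate_polynomials_power coordinate_polynomials.intros) auto
  from coordinate_polynomials_mixed[OF this]
  have "A \<in> constructible (mixed_polynomials k)" unfolding A_def
    by (intro constructible_inter constructible.compl mixed.constructible_INT mixed.ring_zero_set constructible.pos
        mixed_polynomials.add mixed_polynomials.mult mixed_polynomials.const mixed_polynomials.linear
        coordinate_polynomials_mixed[OF assms] bounded_linear_inner_left finite_Basis)
  then have "semialgebraic {y. \<exists>w. (\<forall>i\<ge>k. w i = 0) \<and> (y, w) \<in> A}" by (rule semialgebraic_exists)
  moreover have "(y, w) \<in> A \<longleftrightarrow> (\<Sum>i<k. (w i)\<^sup>2) \<le> 1 \<and> y = F w" for y w
    by (auto simp: A_def euclidean_eq_iff[of y "F w"] not_less)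
  then have "{y. \<exists>w. (\<forall>i\<ge>k. w i = 0) \<and> (y, w) \<in> A} = F ` closed_unit_ball k"
    by (auto simp: closed_unit_ball_def)
  ultimately show ?thesis by simp
qed

section \<open>Polynomials with coefficients depending on time\<close>

text \<open>
  Different indices may carry the same exponents; this spares the closure lemmas below the
  collection of like terms.
\<close>

lemma C0_polynomial_indexed:
  fixes c :: "'k \<Rightarrow> real \<Rightarrow> real" and e :: "'k \<Rightarrow> nat \<Rightarrow> nat"
  assumes "finite I" "\<And>k. k \<in> I \<Longrightarrow> continuous_on {0..1} (c k)"
    and h: "\<And>t x. t \<in> {0..1} \<Longrightarrow> x \<in> closed_unit_ball m \<Longrightarrow> h (t, x) = (\<Sum>k\<in>I. c k t * (\<Prod>i<m. x i ^ e k i))"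
  shows "C0_polynomial_on_ball m h"
  unfolding C0_polynomial_on_ball_def
proof (intro exI conjI ballI)
  show "finite (e ` I)" using assms(1) by simp
  show "continuous_on {0..1} ((\<lambda>\<alpha> t. \<Sum>k\<in>{k\<in>I. e k = \<alpha>}. c k t) \<alpha>)" for \<alpha>
    using assms(2) by (intro continuous_on_sum) auto
  fix t :: real and x assume "t \<in> {0..1}" "x \<in> closed_unit_ball m"
  then have "h (t, x) = (\<Sum>\<alpha>\<in>e ` I. \<Sum>k\<in>{k\<in>I. e k = \<alpha>}. c k t * (\<Prod>i<m. x i ^ e k i))"
    by (simp add: h sum.image_gen[OF assms(1), where g = e])
  also have "\<dots> = (\<Sum>\<alpha>\<in>e ` I. (\<Sum>k\<in>{k\<in>I. e k = \<alpha>}. c k t) * (\<Prod>i<m. x i ^ \<alpha> i))"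
    by (intro sum.cong refl) (simp add: sum_distrib_right)
  finally show "h (t, x) = (\<Sum>\<alpha>\<in>e ` I. (\<lambda>\<alpha> t. \<Sum>k\<in>{k\<in>I. e k = \<alpha>}. c k t) \<alpha> t * (\<Prod>i<m. x i ^ \<alpha> i))" .
qed

lemma C0_polynomialE:
  assumes "C0_polynomial_on_ball m h"
  obtains A c where "finite A" "\<And>\<alpha>. \<alpha> \<in> A \<Longrightarrow> continuous_on {0..1} (c \<alpha>)"
    "\<And>t x. t \<in> {0..1} \<Longrightarrow> x \<in> closed_unit_ball m \<Longrightarrow> h (t, x) = (\<Sum>\<alpha>\<in>A. c \<alpha> t * (\<Prod>i<m. x i ^ \<alpha> i))"
proof -
  from assms obtain A c where *: "finite A" "\<forall>\<alpha>\<in>A. continuous_on {0..1} (c \<alpha>)"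
    "\<forall>t\<in>{0..1}. \<forall>x\<in>closed_unit_ball m. h (t, x) = (\<Sum>\<alpha>\<in>A. c \<alpha> t * (\<Prod>i<m. x i ^ \<alpha> i))"
    unfolding C0_polynomial_on_ball_def by (elim exE conjE)
  show thesis by (rule that[of A c]) (use * in auto)
qed

lemma C0_polynomial_coefficient:
  assumes "continuous_on {0..1} a" shows "C0_polynomial_on_ball m (\<lambda>z. a (fst z))"
  using assms by (intro C0_polynomial_indexed[where I = "{()}" and c = "\<lambda>_. a" and e = "\<lambda>_ _. 0"]) auto

lemma C0_polynomial_var:
  assumes "i < m" shows "C0_polynomial_on_ball m (\<lambda>z. snd z i)"
proof (rule C0_polynomial_indexed[where I = "{()}" and c = "\<lambda>_ _. 1" and e = "\<lambda>_ j. if j = i then 1 else 0"])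
  fix x :: "nat \<Rightarrow> real"
  have "(\<Prod>j<m. x j ^ (if j = i then 1 else 0)) = (\<Prod>j<m. if j = i then x j else 1)"
    by (intro prod.cong) auto
  then show "snd (t, x) i = (\<Sum>k\<in>{()}. 1 * (\<Prod>j<m. x j ^ (if j = i then 1 else 0)))" for t :: real
    using assms by simp
qed auto

lemma C0_polynomial_add:
  assumes "C0_polynomial_on_ball m g" "C0_polynomial_on_ball m h"
  shows "C0_polynomial_on_ball m (\<lambda>z. g z + h z)"
proof -
  obtain A c where A: "finite A" "\<And>\<alpha>. \<alpha> \<in> A \<Longrightarrow> continuous_on {0..1} (c \<alpha>)"
    "\<And>t x. t \<in> {0..1} \<Longrightarrow> x \<in> closed_unit_ball m \<Longrightarrow> g (t, x) = (\<Sum>\<alpha>\<in>A. c \<alpha> t * (\<Prod>i<m. x i ^ \<alpha> i))"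
    using assms(1) by (rule C0_polynomialE) blast
  obtain B d where B: "finite B" "\<And>\<alpha>. \<alpha> \<in> B \<Longrightarrow> continuous_on {0..1} (d \<alpha>)"
    "\<And>t x. t \<in> {0..1} \<Longrightarrow> x \<in> closed_unit_ball m \<Longrightarrow> h (t, x) = (\<Sum>\<alpha>\<in>B. d \<alpha> t * (\<Prod>i<m. x i ^ \<alpha> i))"
    using assms(2) by (rule C0_polynomialE) blast
  show ?thesis
  proof (rule C0_polynomial_indexed[where I = "A <+> B" and c = "case_sum c d" and e = "case_sum id id"])
    show "finite (A <+> B)" using A B by simp
  next
    fix t :: real and x assume "t \<in> {0..1}" "x \<in> closed_unit_ball m"
    then show "g (t, x) + h (t, x) = (\<Sum>k\<in>A <+> B. case_sum c d k t * (\<Prod>i<m. x i ^ case_sum id id k i))"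
      using A B by (simp add: sum.Plus o_def)
  qed (use A B in auto)
qed

lemma C0_polynomial_mult:
  assumes "C0_polynomial_on_ball m g" "C0_polynomial_on_ball m h"
  shows "C0_polynomial_on_ball m (\<lambda>z. g z * h z)"
proof -
  obtain A c where A: "finite A" "\<And>\<alpha>. \<alpha> \<in> A \<Longrightarrow> continuous_on {0..1} (c \<alpha>)"
    "\<And>t x. t \<in> {0..1} \<Longrightarrow> x \<in> closed_unit_ball m \<Longrightarrow> g (t, x) = (\<Sum>\<alpha>\<in>A. c \<alpha> t * (\<Prod>i<m. x i ^ \<alpha> i))"
    using assms(1) by (rule C0_polynomialE) blast
  obtain B d where B: "finite B" "\<And>\<alpha>. \<alpha> \<in> B \<Longrightarrow> continuous_on {0..1} (d \<alpha>)"
    "\<And>t x. t \<in> {0..1} \<Longrightarrow> x \<in> closed_unit_ball m \<Longrightarrow> h (t, x) = (\<Sum>\<alpha>\<in>B. d \<alpha> t * (\<Prod>i<m. x i ^ \<alpha> i))"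
    using assms(2) by (rule C0_polynomialE) blast
  show ?thesis
  proof (rule C0_polynomial_indexed[where I = "A \<times> B" and c = "\<lambda>k t. c (fst k) t * d (snd k) t" 
        and e = "\<lambda>k i. fst k i + snd k i"])
    fix t :: real and x assume "t \<in> {0..1}" "x \<in> closed_unit_ball m"
    then have "g (t, x) * h (t, x) = 
        (\<Sum>(\<alpha>, \<beta>)\<in>A \<times> B. (c \<alpha> t * (\<Prod>i<m. x i ^ \<alpha> i)) * (d \<beta> t * (\<Prod>i<m. x i ^ \<beta> i)))"
      using A B by (simp add: sum_product sum.cartesian_product)
    also have "\<dots> = (\<Sum>k\<in>A \<times> B. c (fst k) t * d (snd k) t * (\<Prod>i<m. x i ^ (fst k i + snd k i)))"
      by (intro sum.cong) (auto simp: power_add prod.distrib)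
    finally show "g (t, x) * h (t, x) = (\<Sum>k\<in>A \<times> B. c (fst k) t * d (snd k) t * (\<Prod>i<m. x i ^ (fst k i + snd k i)))" .
  qed (use A B in \<open>auto intro!: continuous_on_mult\<close>)
qed

lemma coordinate_polynomials_C0:
  "p \<in> coordinate_polynomials m \<Longrightarrow> C0_polynomial_on_ball m (\<lambda>z. p (snd z))"
proof (induction rule: coordinate_polynomials.induct)
  case (const c)
  then show ?case using C0_polynomial_coefficient[of "\<lambda>_. c"] by simp
qed (auto intro: C0_polynomial_var C0_polynomial_add C0_polynomial_mult)

lemma coordinate_polynomials_continuous:
  "p \<in> coordinate_polynomials m \<Longrightarrow> continuous_on UNIV p"
  by (induction rule: coordinate_polynomials.induct) 
    (auto intro: continuous_intros continuous_on_product_coordinates)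

lemma coordinate_polynomials_compose:
  fixes g :: "real ^ 'm \<Rightarrow> real"
  assumes "real_polynomial_function g" and V: "\<And>j. (\<lambda>w. V w $ j) \<in> coordinate_polynomials k"
  shows "(\<lambda>w. g (V w)) \<in> coordinate_polynomials k"
  using assms(1)
proof induction
  case (linear g)
  then interpret bounded_linear g .
  have eq: "g v = (\<Sum>j\<in>UNIV. g (axis j 1) * v $ j)" for v
  proof -
    have "g v = g (\<Sum>j\<in>UNIV. v $ j *\<^sub>R axis j 1)" using basis_expansion[of v] by (simp add: scalar_mult_eq_scaleR)
    then show ?thesis by (simp add: sum scaleR mult.commute)
  qed
  have "(\<lambda>w. \<Sum>j\<in>UNIV. g (axis j 1) * V w $ j) \<in> coordinate_polynomials k"
    by (intro coordinate_polynomials_sum coordinate_polynomials.mult coordinate_polynomials.const V)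
  then show ?case by (subst eq)
qed (auto intro: coordinate_polynomials.intros)

section \<open>Covering the ball by a small ball\<close>

text \<open>
  For \<open>n > 0\<close> the polynomial \<open>cover n\<close> maps \<open>[0, 1]\<close> into itself, and \<open>[0, 1 / (2 n + 1)]\<close> already onto \<open>[0, 1]\<close>.
  It is \<open>x (1 - x)\<^sup>2\<^sup>n\<close>, normalised to have the value \<open>1\<close> at its maximum point \<open>1 / (2 n + 1)\<close>.
  Being \<open>x\<close> times a square, it describes the squared length of a radial polynomial map of a ball.
\<close>

definition squeeze :: "nat \<Rightarrow> real \<Rightarrow> real" where
  "squeeze n x = ((1 - x) * ((2 * real n + 1) / (2 * real n))) ^ n"

definition cover :: "nat \<Rightarrow> real \<Rightarrow> real" where
  "cover n x = (2 * real n + 1) * x * (squeeze n x)\<^sup>2"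

text \<open>
  With \<open>a = (2 n + 1) x\<close> the bound \<open>1 + y \<le> exp y\<close> gives \<open>cover n x \<le> a exp (1 - a)\<close>, and
  \<open>a \<le> exp (a - 1)\<close> by the same bound.
\<close>

lemma cover_range:
  assumes "n > 0" "0 \<le> x" "x \<le> 1"
  shows "0 \<le> cover n x" "cover n x \<le> 1"
proof -
  show "0 \<le> cover n x" using assms by (simp add: cover_def)
  define a where "a = (2 * real n + 1) * x"
  have eq: "(1 - x) * ((2 * real n + 1) / (2 * real n)) = 1 + (1 - a) / (2 * real n)"
    using assms by (simp add: a_def field_simps)
  have "(squeeze n x)\<^sup>2 = (1 + (1 - a) / (2 * real n)) ^ (2 * n)"
    unfolding squeeze_def eq by (simp only: power_mult[symmetric] mult.commute[of n 2])
  also have "\<dots> = (1 + (1 - a) / real (2 * n)) ^ (2 * n)" by simp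
  also have "\<dots> \<le> (exp ((1 - a) / real (2 * n))) ^ (2 * n)"
  proof (rule power_mono)
    have "0 \<le> (1 - x) * ((2 * real n + 1) / (2 * real n))" using assms by simp
    then show "0 \<le> 1 + (1 - a) / real (2 * n)" unfolding eq by simp
  qed (rule exp_ge_add_one_self)
  also have "\<dots> = exp (1 - a)" using assms(1) by (simp flip: exp_of_nat_mult)
  finally have "cover n x \<le> a * exp (1 - a)"
    unfolding cover_def a_def using assms by (intro mult_left_mono) auto
  also have "\<dots> \<le> exp (a - 1) * exp (1 - a)"
    using exp_ge_add_one_self[of "a - 1"] by (intro mult_right_mono) auto
  also have "\<dots> = 1" by (simp flip: exp_add)
  finally show "cover n x \<le> 1" .
qed

lemma cover_onto:
  assumes "n > 0" "0 \<le> y" "y \<le> 1"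
  shows "\<exists>x. 0 \<le> x \<and> x \<le> 1 / (2 * real n + 1) \<and> cover n x = y"
proof -
  have "cover n 0 = 0" by (simp add: cover_def)
  moreover have "1 - 1 / (2 * real n + 1) = 2 * real n / (2 * real n + 1)" 
    by (simp add: field_simps)
  then have "(1 - 1 / (2 * real n + 1)) * ((2 * real n + 1) / (2 * real n)) = 1"
    using assms(1) of_nat_0_le_iff[of n, where 'a=real] by (simp del: of_nat_0_le_iff)
  then have "cover n (1 / (2 * real n + 1)) = 1" 
    using assms by (simp add: cover_def squeeze_def)
  moreover have "continuous_on {0..1 / (2 * real n + 1)} (cover n)"
    unfolding cover_def squeeze_def by (intro continuous_intros)
  ultimately show ?thesis
    using IVT'[of "cover n" 0 y "1 / (2 * real n + 1)"] assms by auto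
qed

text \<open>
  For \<open>n > 0\<close> the closed ball of radius \<open>1 / sqrt (2 n + 1)\<close> around the origin is mapped onto the unit
  ball, while the whole unit ball is still mapped into itself. Since \<open>2 n + 1\<close> such radii have squares
  adding up to \<open>1\<close>, one unit ball covers a product of \<open>2 n + 1\<close> balls in this way.
\<close>

definition ball_cover :: "nat \<Rightarrow> 'a::real_inner \<Rightarrow> 'a" where
  "ball_cover n u = (sqrt (2 * real n + 1) * squeeze n (u \<bullet> u)) *\<^sub>R u"

lemma norm_ball_cover: "(norm (ball_cover n u))\<^sup>2 = cover n ((norm u)\<^sup>2)"
  unfolding power2_norm_eq_inner by (simp add: ball_cover_def cover_def power2_eq_square)

lemma ball_cover_range:
  assumes "n > 0" "norm u \<le> 1" shows "norm (ball_cover n u) \<le> 1"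
proof -
  have "(norm (ball_cover n u))\<^sup>2 \<le> 1"
    unfolding norm_ball_cover using assms by (intro cover_range) (auto simp: power_le_one)
  then show ?thesis by (simp add: power2_le_iff_abs_le abs_square_le_1)
qed

lemma ball_cover_onto:
  assumes n: "n > 0" and v: "norm v \<le> 1"
  shows "\<exists>u. (norm u)\<^sup>2 \<le> 1 / (2 * real n + 1) \<and> ball_cover n u = v"
proof (cases "v = 0")
  case True
  then show ?thesis by (intro exI[of _ 0]) (simp add: ball_cover_def)
next
  case False
  have "(norm v)\<^sup>2 \<le> 1" using v by (simp add: power_le_one)
  then obtain x where x: "0 \<le> x" "x \<le> 1 / (2 * real n + 1)" "cover n x = (norm v)\<^sup>2"
    using cover_onto[OF n, of "(norm v)\<^sup>2"] by auto
  define u where "u = (sqrt x / norm v) *\<^sub>R v"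
  have nu: "(norm u)\<^sup>2 = x" using x(1) False by (simp add: u_def power_divide)
  have "1 / (2 * real n + 1) \<le> 1" by simp
  then have "x \<le> 1" using x(2) by linarith
  then have s0: "squeeze n x \<ge> 0" by (simp add: squeeze_def)
  have "sqrt (2 * real n + 1) * squeeze n x * sqrt x = norm v"
  proof (rule power2_eq_imp_eq)
    show "(sqrt (2 * real n + 1) * squeeze n x * sqrt x)\<^sup>2 = (norm v)\<^sup>2"
      using x by (simp add: power_mult_distrib cover_def mult_ac)
  qed (use s0 x in auto)
  then have "ball_cover n u = v"
    using nu False by (simp add: ball_cover_def u_def[symmetric] flip: power2_norm_eq_inner) (simp add: u_def)
  then show ?thesis using nu x(2) by (intro exI[of _ u]) simp
qed

section \<open>The convex hull as a polynomial image of a ball\<close>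

text \<open>
  All points of a simplex arise from its vertices by moving from the current point towards the next
  vertex, with one free parameter in \<open>[0, 1]\<close> per step. Thus \<open>n + 1\<close> points need only \<open>n\<close> parameters, which
  range over a cube.
\<close>

fun iterated_combination :: "(nat \<Rightarrow> 'a::real_vector) \<Rightarrow> (nat \<Rightarrow> real) \<Rightarrow> nat \<Rightarrow> 'a" where
  "iterated_combination v s 0 = v 0"
| "iterated_combination v s (Suc k) = (1 - s k) *\<^sub>R iterated_combination v s k + s k *\<^sub>R v (Suc k)"

lemma iterated_combination_cong:
  assumes "\<And>i. i \<le> k \<Longrightarrow> v i = v' i" "\<And>i. i < k \<Longrightarrow> s i = s' i"
  shows "iterated_combination v s k = iterated_combination v' s' k"
  using assms by (induction k) auto

lemma iterated_combination_in_hull: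
  assumes "\<And>i. i \<le> k \<Longrightarrow> v i \<in> S" "\<And>i. i < k \<Longrightarrow> 0 \<le> s i \<and> s i \<le> 1"
  shows "iterated_combination v s k \<in> convex hull S"
  using assms
proof (induction k)
  case 0
  then show ?case by (simp add: hull_inc)
next
  case (Suc k)
  then show ?case using convexD[OF convex_convex_hull[of S], of "iterated_combination v s k" "v (Suc k)" "1 - s k" "s k"]
    by (simp add: hull_inc)
qed

lemma convex_hull_iterated_combination:
  assumes "finite V" "V \<noteq> {}" "card V \<le> Suc k" "x \<in> convex hull V"
  shows "\<exists>v s. (\<forall>i. v i \<in> V) \<and> (\<forall>i. 0 \<le> s i \<and> s i \<le> 1) \<and> iterated_combination v s k = x"
  using assms
proof (induction k arbitrary: V x)
  case 0
  then have "card V = 1" by (simp add: card_gt_0_iff le_antisym Suc_le_eq)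
  then obtain a where "V = {a}" by (rule card_1_singletonE)
  then show ?case using 0 by (intro exI[of _ "\<lambda>_. a"] exI[of _ "\<lambda>_. 0"]) auto
next
  case (Suc k)
  show ?case
  proof (cases "card V \<le> Suc k")
    case True
    then obtain v s where vs: "\<forall>i. v i \<in> V" "\<forall>i. 0 \<le> s i \<and> s i \<le> 1" "iterated_combination v s k = x"
      using Suc.IH[OF Suc.prems(1,2) _ Suc.prems(4)] by blast
    define s' where "s' i = (if i = k then 0 else s i)" for i
    have "iterated_combination v s' k = x" 
      using vs(3) iterated_combination_cong[of k v v s' s] by (simp add: s'_def)
    then have "iterated_combination v s' (Suc k) = x" by (simp add: s'_def)
    moreover have "\<forall>i. 0 \<le> s' i \<and> s' i \<le> 1" using vs(2) by (simp add: s'_def)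
    ultimately show ?thesis using vs(1) by blast
  next
    case False
    obtain b where b: "b \<in> V" using Suc.prems(2) by auto
    define W where "W = V - {b}"
    have V: "V = insert b W" "b \<notin> W" using b by (auto simp: W_def)
    have cW: "card W = Suc k" using V Suc.prems(1,3) False by simp
    then have W: "finite W" "W \<noteq> {}" using V Suc.prems(1) by auto
    obtain u a w where u: "0 \<le> u" "0 \<le> w" "u + w = 1" "a \<in> convex hull W" "x = u *\<^sub>R b + w *\<^sub>R a"
      using Suc.prems(4) unfolding V(1) convex_hull_insert[OF W(2)] by auto
    obtain v s where vs: "\<forall>i. v i \<in> W" "\<forall>i. 0 \<le> s i \<and> s i \<le> 1" "iterated_combination v s k = a"
      using Suc.IH[OF W _ u(4)] cW by auto
    define v' where "v' i = (if i = Suc k then b else v i)" for i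
    define s' where "s' i = (if i = k then u else s i)" for i
    have "iterated_combination v' s' k = a"
      using vs(3) iterated_combination_cong[of k v' v s' s] by (simp add: v'_def s'_def)
    moreover have "1 - u = w" using u by simp
    ultimately have "iterated_combination v' s' (Suc k) = x" 
      using u(5) by (simp add: v'_def s'_def)
    moreover have "\<forall>i. v' i \<in> V" using vs(1) V by (simp add: v'_def)
    moreover have "\<forall>i. 0 \<le> s' i \<and> s' i \<le> 1" using vs(2) u by (simp add: s'_def)
    ultimately show ?thesis by blast
  qed
qed

lemma ex_enumeration: "\<exists>\<iota> :: 'n::finite \<Rightarrow> nat. bij_betw \<iota> UNIV {..<CARD('n)}"
  using ex_bij_betw_finite_nat[OF finite[of "UNIV :: 'n set"]] by (simp add: atLeast0LessThan)

text \<open>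
  The first \<open>CARD('m) * (n + 1)\<close> coordinates of a point are read as \<open>n + 1\<close> consecutive vectors;
  \<open>\<iota>\<close> numbers the components of a vector.
\<close>

definition block :: "('m::finite \<Rightarrow> nat) \<Rightarrow> nat \<Rightarrow> (nat \<Rightarrow> real) \<Rightarrow> real ^ 'm" where
  "block \<iota> k w = (\<chi> j. w (k * CARD('m) + \<iota> j))"

lemma inner_block_self:
  fixes \<iota> :: "'m::finite \<Rightarrow> nat"
  assumes "bij_betw \<iota> UNIV {..<CARD('m)}"
  shows "block \<iota> k w \<bullet> block \<iota> k w = (\<Sum>i\<in>{k * CARD('m)..<k * CARD('m) + CARD('m)}. (w i)\<^sup>2)"
proof -
  have "bij_betw ((+) (k * CARD('m))) {..<CARD('m)} {k * CARD('m)..<k * CARD('m) + CARD('m)}"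
    by (rule bij_betw_byWitness[where f' = "\<lambda>i. i - k * CARD('m)"]) auto
  from bij_betw_trans[OF assms this]
  have "bij_betw (\<lambda>j. k * CARD('m) + \<iota> j) UNIV {k * CARD('m)..<k * CARD('m) + CARD('m)}"
    by (simp add: o_def)
  from sum.reindex_bij_betw[OF this, of "\<lambda>i. (w i)\<^sup>2"] show ?thesis
    by (simp add: block_def inner_vec_def power2_eq_square)
qed

lemma sum_squares_blocks:
  fixes \<iota> :: "'m::finite \<Rightarrow> nat"
  assumes "bij_betw \<iota> UNIV {..<CARD('m)}"
  shows "(\<Sum>i<CARD('m) * (n + 1) + n. (w i)\<^sup>2) = 
    (\<Sum>k<n + 1. block \<iota> k w \<bullet> block \<iota> k w) + (\<Sum>k<n. (w (CARD('m) * (n + 1) + k))\<^sup>2)"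
proof -
  have split: "(\<Sum>i<a + b. f i) = (\<Sum>i<a. f i) + (\<Sum>k<b. f (a + k))" for a b and f :: "nat \<Rightarrow> real"
    by (induction b) (auto simp: add.assoc)
  have "(\<Sum>k<n + 1. block \<iota> k w \<bullet> block \<iota> k w) = (\<Sum>i<(n + 1) * CARD('m). (w i)\<^sup>2)"
    by (simp only: inner_block_self[OF assms] sum.nat_group)
  then show ?thesis unfolding split by (simp add: mult.commute)
qed

lemma coordinate_polynomials_squeeze:
  assumes "p \<in> coordinate_polynomials k" shows "(\<lambda>w. squeeze n (p w)) \<in> coordinate_polynomials k"
  unfolding squeeze_def
  by (intro coordinate_polynomials_power coordinate_polynomials.mult coordinate_polynomials_diff 
      coordinate_polynomials.const assms)

lemma coordinate_polynomials_cover: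
  assumes "p \<in> coordinate_polynomials k" shows "(\<lambda>w. cover n (p w)) \<in> coordinate_polynomials k"
  unfolding cover_def
  by (intro coordinate_polynomials_power coordinate_polynomials.mult coordinate_polynomials_squeeze
      coordinate_polynomials.const assms)

lemma coordinate_polynomials_ball_cover:
  fixes V :: "(nat \<Rightarrow> real) \<Rightarrow> real ^ 'm"
  assumes V: "\<And>j. (\<lambda>w. V w $ j) \<in> coordinate_polynomials k"
  shows "(\<lambda>w. ball_cover n (V w) $ j) \<in> coordinate_polynomials k"
proof -
  have "(\<lambda>w. \<Sum>i\<in>UNIV. V w $ i * V w $ i) \<in> coordinate_polynomials k"
    by (intro coordinate_polynomials_sum coordinate_polynomials.mult V)
  then have "(\<lambda>w. V w \<bullet> V w) \<in> coordinate_polynomials k" by (simp add: inner_vec_def)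
  then have "(\<lambda>w. (sqrt (2 * real n + 1) * squeeze n (V w \<bullet> V w)) * V w $ j) \<in> coordinate_polynomials k"
    by (intro coordinate_polynomials.mult coordinate_polynomials_squeeze coordinate_polynomials.const V)
  then show ?thesis by (simp add: ball_cover_def)
qed

lemma coordinate_polynomials_iterated_combination:
  fixes v :: "nat \<Rightarrow> (nat \<Rightarrow> real) \<Rightarrow> real ^ 'n"
  assumes "\<And>i. i \<le> n \<Longrightarrow> (\<lambda>w. v i w $ j) \<in> coordinate_polynomials k" 
    and "\<And>i. i < n \<Longrightarrow> s i \<in> coordinate_polynomials k"
  shows "(\<lambda>w. iterated_combination (\<lambda>i. v i w) (\<lambda>i. s i w) n $ j) \<in> coordinate_polynomials k"
  using assms
proof (induction n)
  case (Suc n)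
  then have "(\<lambda>w. (1 - s n w) * iterated_combination (\<lambda>i. v i w) (\<lambda>i. s i w) n $ j + s n w * v (Suc n) w $ j)
      \<in> coordinate_polynomials k"
    by (intro coordinate_polynomials.add coordinate_polynomials.mult coordinate_polynomials_diff 
        coordinate_polynomials.const) auto
  then show ?case by simp
qed simp

text \<open>
  By Caratheodory's theorem a point of the hull is a combination of \<open>n + 1\<close> points \<open>f x\<^sub>0, \<dots>, f x\<^sub>n\<close>.
  The coordinates of the ball supply the \<open>n + 1\<close> vectors and the \<open>n\<close> parameters; after the covering
  maps have been applied to them, each vector ranges over the unit ball and each parameter over \<open>[0, 1]\<close>,
  independently of the others.
\<close>

theorem convex_hull_image_ball:
  fixes f :: "real ^ 'm \<Rightarrow> real ^ 'n"
  assumes f: "polynomial_function f"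
  defines "M \<equiv> CARD('m) * (CARD('n) + 1) + CARD('n)"
  shows "\<exists>F :: (nat \<Rightarrow> real) \<Rightarrow> real ^ 'n. (\<forall>j. (\<lambda>w. F w $ j) \<in> coordinate_polynomials M) \<and>
    F ` closed_unit_ball M = convex hull (f ` cball 0 1)"
proof -
  define n where "n = CARD('n)"
  have n: "n > 0" by (simp add: n_def)
  obtain \<iota> :: "'m \<Rightarrow> nat" where \<iota>: "bij_betw \<iota> UNIV {..<CARD('m)}"
    using ex_enumeration ..
  have \<iota>_less: "\<iota> j < CARD('m)" for j using bij_betwE[OF \<iota>] by auto
  define a where "a = CARD('m) * (n + 1)"
  have M: "M = a + n" by (simp add: M_def a_def n_def)
  have idx: "k * CARD('m) + \<iota> j < a" if "k \<le> n" for k j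
  proof -
    have "k * CARD('m) + \<iota> j < k * CARD('m) + CARD('m)" using \<iota>_less by simp
    also have "\<dots> = Suc k * CARD('m)" by simp
    also have "\<dots> \<le> (n + 1) * CARD('m)" using that by (intro mult_right_mono) auto
    finally show ?thesis by (simp add: a_def mult.commute)
  qed
  define F where "F w = iterated_combination (\<lambda>k. f (ball_cover n (block \<iota> k w))) (\<lambda>k. cover n ((w (a + k))\<^sup>2)) n" for w
  have poly: "(\<lambda>w. F w $ j) \<in> coordinate_polynomials M" for j
    unfolding F_def
  proof (rule coordinate_polynomials_iterated_combination)
    fix k assume k: "k \<le> n"
    have "real_polynomial_function (\<lambda>u. f u \<bullet> axis j 1)"
      using f by (simp add: polynomial_function_iff_Basis_inner axis_in_Basis_iff)
    then have "real_polynomial_function (\<lambda>u. f u $ j)" by (simp add: inner_axis)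
    moreover have "(\<lambda>w. block \<iota> k w $ i) \<in> coordinate_polynomials M" for i
      using idx[OF k, of i] by (simp add: block_def M coordinate_polynomials.var)
    ultimately show "(\<lambda>w. f (ball_cover n (block \<iota> k w)) $ j) \<in> coordinate_polynomials M"
      by (intro coordinate_polynomials_compose[of "\<lambda>u. f u $ j"] coordinate_polynomials_ball_cover)
  next
    fix k assume "k < n"
    then show "(\<lambda>w. cover n ((w (a + k))\<^sup>2)) \<in> coordinate_polynomials M"
      by (intro coordinate_polynomials_cover coordinate_polynomials_power coordinate_polynomials.var) (simp add: M)
  qed
  let ?B = "closed_unit_ball M" and ?S = "f ` cball 0 1"
  have sq: "(\<Sum>i<M. (w i)\<^sup>2) = (\<Sum>k<n + 1. block \<iota> k w \<bullet> block \<iota> k w) + (\<Sum>k<n. (w (a + k))\<^sup>2)" for w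
    unfolding M a_def by (rule sum_squares_blocks[OF \<iota>])
  have into: "F w \<in> convex hull ?S" if w: "w \<in> ?B" for w
    unfolding F_def
  proof (rule iterated_combination_in_hull)
    define p where "p = (\<Sum>k<n + 1. block \<iota> k w \<bullet> block \<iota> k w)"
    define q where "q = (\<Sum>k<n. (w (a + k))\<^sup>2)"
    have le: "p + q \<le> 1"
      using w unfolding p_def q_def sq[symmetric] by (simp add: closed_unit_ball_def)
    have p0: "0 \<le> p" unfolding p_def by (rule sum_nonneg) (rule inner_ge_zero)
    have q0: "0 \<le> q" unfolding q_def by (rule sum_nonneg) (rule zero_le_power2)
    fix k 
    {
      assume "k \<le> n"
      then have "block \<iota> k w \<bullet> block \<iota> k w \<le> p"
        unfolding p_def by (intro member_le_sum) auto
      then have "norm (block \<iota> k w) \<le> 1" using le q0 by (simp add: norm_le_square)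
      then have "ball_cover n (block \<iota> k w) \<in> cball 0 1" using ball_cover_range[OF n] by simp
      then show "f (ball_cover n (block \<iota> k w)) \<in> ?S" by (rule imageI)
    next
      assume "k < n"
      then have "(w (a + k))\<^sup>2 \<le> q"
        unfolding q_def by (intro member_le_sum) auto
      then have "(w (a + k))\<^sup>2 \<le> 1" using le p0 by linarith
      then show "0 \<le> cover n ((w (a + k))\<^sup>2) \<and> cover n ((w (a + k))\<^sup>2) \<le> 1" 
        using cover_range[OF n] by simp
    }
  qed
  \<comment> \<open>Preimages of the \<open>2 n + 1\<close> ingredients can be chosen with squared length at most
    \<open>1 / (2 n + 1)\<close> each, hence jointly in the unit ball.\<close>
  have onto: "y \<in> F ` ?B" if y: "y \<in> convex hull ?S" for y
  proof -
    obtain V where V: "finite V" "V \<subseteq> ?S" "card V \<le> n + 1" "y \<in> convex hull V"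
      using y unfolding caratheodory[of ?S] by (auto simp: n_def)
    have "V \<noteq> {}" using V(4) by auto
    then obtain v s where vs: "\<forall>i. v i \<in> V" "\<forall>i. 0 \<le> s i \<and> s i \<le> 1" "iterated_combination v s n = y"
      using convex_hull_iterated_combination[OF V(1) _ _ V(4), of n] V(3) by auto
    have "\<exists>u. (norm u)\<^sup>2 \<le> 1 / (2 * real n + 1) \<and> f (ball_cover n u) = v i" for i
    proof -
      have "v i \<in> f ` cball 0 1" using vs(1) V(2) by blast
      then obtain g where "norm g \<le> 1" "v i = f g" by auto
      then show ?thesis using ball_cover_onto[OF n, of g] by auto
    qed
    then have "\<exists>u. \<forall>i. (norm (u i))\<^sup>2 \<le> 1 / (2 * real n + 1) \<and> f (ball_cover n (u i)) = v i"
      by (intro choice allI)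
    then obtain u where u: "\<And>i. (norm (u i))\<^sup>2 \<le> 1 / (2 * real n + 1)" "\<And>i. f (ball_cover n (u i)) = v i"
      by auto
    have "\<exists>x. \<forall>i. 0 \<le> x i \<and> x i \<le> 1 / (2 * real n + 1) \<and> cover n (x i) = s i"
      using cover_onto[OF n] vs(2) by (intro choice allI) simp
    then obtain x where x: "\<And>i. 0 \<le> x i" "\<And>i. x i \<le> 1 / (2 * real n + 1)" "\<And>i. cover n (x i) = s i"
      by auto
    define w where "w i = (if i < a then u (i div CARD('m)) $ inv_into UNIV \<iota> (i mod CARD('m)) 
        else if i < M then sqrt (x (i - a)) else 0)" for i
    have block: "block \<iota> k w = u k" if "k \<le> n" for k
    proof -
      have "inv_into UNIV \<iota> (\<iota> j) = j" for j
        using \<iota> by (intro inv_into_f_f) (auto simp: bij_betw_def)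
      then show ?thesis
        using idx[OF that] \<iota>_less by (simp add: block_def w_def vec_eq_iff)
    qed
    have tail: "(w (a + k))\<^sup>2 = x k" if "k < n" for k
      using that x(1) by (simp add: w_def M)
    have "(\<Sum>k<n + 1. block \<iota> k w \<bullet> block \<iota> k w) \<le> (\<Sum>k<n + 1. 1 / (2 * real n + 1))"
      using u(1) by (intro sum_mono) (simp add: block flip: power2_norm_eq_inner)
    moreover have "(\<Sum>k<n. (w (a + k))\<^sup>2) \<le> (\<Sum>k<n. 1 / (2 * real n + 1))"
      using x(2) by (intro sum_mono) (simp add: tail)
    moreover have "(\<Sum>k<n + 1. 1 / (2 * real n + 1)) + (\<Sum>k<n. 1 / (2 * real n + 1)) = 1"
    proof -
      have "2 * real n + 1 \<noteq> 0" using of_nat_0_le_iff[of n, where 'a=real] by linarith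
      then show ?thesis by (simp add: divide_simps)
    qed
    ultimately have "(\<Sum>i<M. (w i)\<^sup>2) \<le> 1" unfolding sq by linarith
    moreover have "w i = 0" if "i \<ge> M" for i using that by (simp add: w_def M)
    ultimately have "w \<in> ?B" by (simp add: closed_unit_ball_def)
    moreover have "F w = y"
      unfolding F_def vs(3)[symmetric] 
      by (rule iterated_combination_cong) (simp_all add: block tail u(2) x(3))
    ultimately show ?thesis by blast
  qed
  show ?thesis
    using poly into onto by (intro exI[of _ F]) auto
qed

section \<open>Interior and dimension\<close>

text \<open>
  Restricted to a line through the origin, \<open>g\<close> is a polynomial in one variable that takes the value
  \<open>c\<close> infinitely often.
\<close>

lemma polynomial_constant_on_ball:
  fixes g :: "'a::real_normed_vector \<Rightarrow> real"
  assumes g: "real_polynomial_function g" and c: "\<And>x. norm x \<le> 1 \<Longrightarrow> g x = c"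
  shows "g x = c"
proof -
  have "polynomial_function (\<lambda>t :: real. t *\<^sub>R x)"
    by (rule polynomial_function_bounded_linear) (rule bounded_linear_scaleR_left)
  then have "real_polynomial_function (g \<circ> (\<lambda>t :: real. t *\<^sub>R x))"
    using g by (rule real_polynomial_function_compose)
  then have "real_polynomial_function (\<lambda>t. g (t *\<^sub>R x) - c)"
    by (intro real_polynomial_function_diff) (auto simp: o_def)
  then obtain a n where an: "(\<lambda>t. g (t *\<^sub>R x) - c) = (\<lambda>t. \<Sum>i\<le>n. a i * t ^ i)"
    using real_polynomial_function_imp_sum by blast
  have "{0..1 / (norm x + 1)} \<subseteq> {t. (\<Sum>i\<le>n. a i * t ^ i) = 0}"
  proof
    fix t assume t: "t \<in> {0..1 / (norm x + 1)}"
    have "norm x + 1 > 0" by (simp add: add_nonneg_pos)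
    then have "t * (norm x + 1) \<le> 1" using t by (simp add: pos_le_divide_eq)
    then have "norm (t *\<^sub>R x) \<le> 1" using t by (simp add: distrib_left)
    then have "g (t *\<^sub>R x) - c = 0" using c by simp
    then show "t \<in> {t. (\<Sum>i\<le>n. a i * t ^ i) = 0}" using fun_cong[OF an, of t] by simp
  qed
  moreover have "infinite {0..1 / (norm x + 1)}"
    by (intro infinite_Icc) (simp add: add_nonneg_pos)
  ultimately have "infinite {t. (\<Sum>i\<le>n. a i * t ^ i) = 0}" using finite_subset by blast
  then have "\<forall>k\<le>n. a k = 0" using polyfun_finite_roots[of a n] by blast
  then show ?thesis using fun_cong[OF an, of 1] by simp
qed

lemma interior_convex_hull_image_ball:
  fixes f :: "real ^ 'm \<Rightarrow> real ^ 'n"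
  assumes f: "polynomial_function f" and nh: "\<not> (\<exists>P. hyperplane P \<and> range f \<subseteq> P)"
  shows "interior (convex hull (f ` cball 0 1)) \<noteq> {}"
proof
  assume "interior (convex hull (f ` cball 0 1)) = {}"
  then obtain a b where ab: "a \<noteq> 0" "convex hull (f ` cball 0 1) \<subseteq> {x. a \<bullet> x = b}"
    by (rule empty_interior_subset_hyperplane[OF convex_convex_hull])
  have "real_polynomial_function ((\<lambda>y. a \<bullet> y) \<circ> f)"
    by (intro real_polynomial_function_compose[OF f] real_polynomial_function.intros(1) bounded_linear_inner_right)
  moreover have "((\<lambda>y. a \<bullet> y) \<circ> f) x = b" if "norm x \<le> 1" for x
    using ab(2) that by (auto simp: hull_inc subset_iff)
  ultimately have "((\<lambda>y. a \<bullet> y) \<circ> f) x = b" for x by (rule polynomial_constant_on_ball)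
  then have "range f \<subseteq> {x. a \<bullet> x = b}" by auto
  then show False using nh ab(1) by (auto simp: hyperplane_def)
qed

lemma open_unit_cube_homeomorphic_subset:
  fixes T :: "(real ^ 'n) set"
  assumes "interior T \<noteq> {}"
  shows "\<exists>U\<subseteq>T. U homeomorphic open_unit_cube CARD('n)"
proof -
  let ?n = "CARD('n)" and ?C = "open_unit_cube CARD('n)"
  obtain p e where e: "e > 0" "ball p e \<subseteq> T" using assms by (auto simp: mem_interior)
  obtain \<iota> :: "'n \<Rightarrow> nat" where \<iota>: "bij_betw \<iota> UNIV {..<?n}"
    using ex_enumeration ..
  have \<iota>_less: "\<iota> j < ?n" for j using bij_betwE[OF \<iota>] by auto
  have inv2: "\<iota> (inv_into UNIV \<iota> i) = i" if "i < ?n" for i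
    using \<iota> that by (intro f_inv_into_f) (auto simp: bij_betw_def)
  define d where "d = e / real ?n"
  have d: "d > 0" using e by (simp add: d_def)
  define h :: "(nat \<Rightarrow> real) \<Rightarrow> real ^ 'n" where "h w = (\<chi> j. p $ j + d * w (\<iota> j))" for w
  define g :: "real ^ 'n \<Rightarrow> nat \<Rightarrow> real" where 
    "g v i = (if i < ?n then (v $ inv_into UNIV \<iota> i - p $ inv_into UNIV \<iota> i) / d else 0)" for v i
  have gh: "g (h w) = w" if "w \<in> ?C" for w
    using that d by (auto simp: fun_eq_iff g_def h_def inv2 open_unit_cube_def)
  have "h w \<in> ball p e" if w: "w \<in> ?C" for w
  proof -
    have "norm (h w - p) \<le> (\<Sum>j\<in>UNIV. \<bar>(h w - p) $ j\<bar>)" by (rule norm_le_l1_cart)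
    also have "\<dots> < (\<Sum>j\<in>(UNIV :: 'n set). d)"
    proof (rule sum_strict_mono)
      fix j
      have "0 < w (\<iota> j)" "w (\<iota> j) < 1" using w \<iota>_less by (auto simp: open_unit_cube_def)
      then show "\<bar>(h w - p) $ j\<bar> < d" using d by (simp add: h_def abs_mult)
    qed auto
    also have "\<dots> = e" by (simp add: d_def)
    finally show ?thesis by (simp add: dist_norm norm_minus_commute)
  qed
  then have sub: "h ` ?C \<subseteq> T" using e(2) by blast
  have "homeomorphism ?C (h ` ?C) h g"
  proof (rule homeomorphismI)
    show "continuous_on ?C h" unfolding h_def
      by (intro continuous_on_vec_lambda continuous_intros)
        (rule continuous_on_subset[OF continuous_on_product_coordinates], simp)
    show "continuous_on (h ` ?C) g"
    proof (rule continuous_on_coordinatewise_then_product)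
      fix i show "continuous_on (h ` ?C) (\<lambda>v. g v i)"
        using d by (cases "i < ?n") (auto simp: g_def intro!: continuous_intros)
    qed
  qed (use gh in auto)
  then have "(h ` ?C) homeomorphic ?C" by (meson homeomorphic_def homeomorphic_sym)
  with sub show ?thesis by blast
qed

text \<open>
  An open subset of the space of dimension \<open>CARD('n) + 1\<close> embeds into any cube of larger dimension
  than \<open>CARD('n)\<close>, with the remaining coordinates fixed at \<open>1 / 2\<close>. So such a cube inside \<open>real ^ 'n\<close>
  would contradict the invariance of dimension.
\<close>

lemma open_unit_cube_dimension_le:
  fixes U :: "(real ^ 'n) set"
  assumes "U homeomorphic open_unit_cube e"
  shows "e \<le> CARD('n)"
proof (rule ccontr)
  assume "\<not> e \<le> CARD('n)"
  then have e: "CARD('n) < e" by simp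
  let ?n = "CARD('n)"
  obtain k k' where kk: "homeomorphism (open_unit_cube e) U k k'"
    using assms homeomorphic_sym by (metis homeomorphic_def)
  obtain \<iota> :: "'n \<Rightarrow> nat" where \<iota>: "bij_betw \<iota> UNIV {..<?n}"
    using ex_enumeration ..
  have \<iota>_less: "\<iota> j < ?n" for j using bij_betwE[OF \<iota>] by auto
  have inv1: "inv_into UNIV \<iota> (\<iota> j) = j" for j
    using \<iota> by (intro inv_into_f_f) (auto simp: bij_betw_def)
  define q :: "(real ^ 'n) \<times> real \<Rightarrow> nat \<Rightarrow> real" where
    "q z i = (if i < ?n then fst z $ inv_into UNIV \<iota> i else if i = ?n then snd z else if i < e then 1 / 2 else 0)" for z i
  let ?W = "box (0 :: real ^ 'n) 1 \<times> {0<..<1::real}"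
  have qW: "q z \<in> open_unit_cube e" if "z \<in> ?W" for z
    using that e by (auto simp: q_def open_unit_cube_def mem_box_cart)
  have "DIM((real ^ 'n) \<times> real) \<le> DIM(real ^ 'n)"
  proof (rule invariance_of_dimension)
    have "continuous_on ?W q"
    proof (rule continuous_on_coordinatewise_then_product)
      fix i show "continuous_on ?W (\<lambda>z. q z i)"
        unfolding q_def by (cases "i < ?n"; cases "i = ?n"; cases "i < e") (auto intro!: continuous_intros)
    qed
    then show "continuous_on ?W (\<lambda>z. k (q z))"
      using qW by (intro continuous_on_compose2[OF homeomorphism_cont1[OF kk]]) auto
    show "open ?W" by (intro open_Times open_box open_greaterThanLessThan)
    show "inj_on (\<lambda>z. k (q z)) ?W"
    proof (rule inj_onI)
      fix y z assume y: "y \<in> ?W" and z: "z \<in> ?W" and "k (q y) = k (q z)"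
      then have eq: "q y = q z" using homeomorphism_apply1[OF kk] qW by metis
      have "fst y $ j = fst z $ j" for j using fun_cong[OF eq, of "\<iota> j"] \<iota>_less[of j] by (simp add: q_def inv1)
      moreover have "snd y = snd z" using fun_cong[OF eq, of ?n] by (simp add: q_def)
      ultimately show "y = z" by (simp add: prod_eq_iff vec_eq_iff)
    qed
    have "(\<chi> j. 1 / 2, 1 / 2) \<in> ?W" by (simp add: mem_box_cart)
    then show "?W \<noteq> {}" by blast
  qed
  then show False by simp
qed

section \<open>Contraction to an interior point\<close>

text \<open>
  The homotopy contracts linearly to an interior point \<open>c\<close>: a point of a convex set that is moved
  towards an interior point by a positive amount becomes interior.
\<close>

theorem corollary2p15:
  fixes f :: "real ^ 'm \<Rightarrow> real ^ 'n" and S :: "(real ^ 'n) set"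
  assumes "polynomial_function f"
    and "S = f ` cball 0 1"
    and "\<not> (\<exists>P. hyperplane P \<and> range f \<subseteq> P)"
  shows "brick (CARD('m) * (CARD('n) + 1) + CARD('n)) (convex hull S)"
proof -
  define M where "M = CARD('m) * (CARD('n) + 1) + CARD('n)"
  let ?T = "convex hull S"
  obtain F :: "(nat \<Rightarrow> real) \<Rightarrow> real ^ 'n" where F: "\<And>j. (\<lambda>w. F w $ j) \<in> coordinate_polynomials M"
    and onto: "F ` closed_unit_ball M = ?T"
    using convex_hull_image_ball[OF assms(1)] unfolding M_def assms(2) by blast
  have int: "interior ?T \<noteq> {}"
    using interior_convex_hull_image_ball[OF assms(1,3)] assms(2) by simp
  then obtain c where c: "c \<in> interior ?T" by blast
  have semi: "semialgebraic ?T"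
    unfolding onto[symmetric]
    by (rule semialgebraic_polynomial_image_ball) (auto simp: Basis_vec_def inner_axis F)
  have dim: "has_semialgebraic_dim ?T CARD('n)"
    unfolding has_semialgebraic_dim_def
    using open_unit_cube_homeomorphic_subset[OF int] open_unit_cube_dimension_le by blast
  define H where "H z = (1 - fst z) *\<^sub>R F (snd z) + fst z *\<^sub>R c" for z :: "real \<times> (nat \<Rightarrow> real)"
  have contF: "continuous_on UNIV F"
    using coordinate_polynomials_continuous[OF F] 
    by (simp add: continuous_on_componentwise[of UNIV F] Basis_vec_def inner_axis)
  have contH: "continuous_on ({0..1} \<times> closed_unit_ball M) H"
    unfolding H_def by (intro continuous_intros continuous_on_compose2[OF contF]) auto
  have FT: "F x \<in> ?T" if "x \<in> closed_unit_ball M" for x using onto that by blast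
  have interior: "H (t, x) \<in> interior ?T" if "0 < t" "t \<le> 1" "x \<in> closed_unit_ball M" for t x
    using mem_interior_convex_shrink[OF convex_convex_hull c FT[OF that(3)] that(1,2)]
    by (simp add: H_def algebra_simps)
  have H0: "H (0, x) = F x" for x by (simp add: H_def)
  have "H ` ({0..1} \<times> closed_unit_ball M) \<subseteq> ?T"
  proof clarify
    fix t :: real and x assume t: "t \<in> {0..1}" and x: "x \<in> closed_unit_ball M"
    show "H (t, x) \<in> ?T"
    proof (cases "t = 0")
      case True
      then show ?thesis using H0 FT[OF x] by simp
    next
      case False
      then show ?thesis using interior[of t x] t x interior_subset[of ?T] by auto
    qed
  qed
  moreover have "C0_polynomial_on_ball M (\<lambda>z. H z $ j)" for j
  proof -
    have "C0_polynomial_on_ball M (\<lambda>z. (1 - fst z) * (F (snd z) $ j) + fst z * c $ j)"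
      by (intro C0_polynomial_add C0_polynomial_mult C0_polynomial_coefficient[of "\<lambda>t. 1 - t"]
          C0_polynomial_coefficient[of "\<lambda>t. t * c $ j"] coordinate_polynomials_C0 F continuous_intros)
    then show ?thesis by (simp add: H_def)
  qed
  moreover have "H ` ({0} \<times> closed_unit_ball M) = ?T"
  proof -
    have "H ` ({0} \<times> closed_unit_ball M) = F ` closed_unit_ball M"
      using H0 by (auto simp: image_iff)
    then show ?thesis using onto by simp
  qed
  moreover have "\<exists>c. \<forall>x\<in>closed_unit_ball M. H (1, x) = c"
    by (intro exI[of _ c]) (simp add: H_def)
  moreover have "\<forall>t\<in>{0<..<1}. H ` ({t} \<times> closed_unit_ball M) \<subseteq> interior ?T"
    using interior by auto
  ultimately show ?thesis
    unfolding brick_def M_def[symmetric] using semi dim contH by blast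
qed

end
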